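(* (Completeness of $QLET_F$.) Let $\mathcal{S}=\langle\mathcal{C},\mathcal{P}\rangle$ be a signature and let $\Gamma\cup\{A\}\subseteq Sent(\mathcal{S})$. If $\Gamma\vDash A$, then $\Gamma\vdash A$ in $QLET_F$.
   Context: **Language.** A signature is a pair $\mathcal{S}=\langle\mathcal{C},\mathcal{P}\rangle$, where $\mathcal{C}$ is an infinite set of individual constants and $\mathcal{P}$ is a set of predicate letters, each of finite arity, containing a binary identity predicate $\approx$. The logical symbols are the unary connectives $\neg,\circ,\bullet$, the binary connectives $\land,\lor$, the quantifiers $\forall,\exists$, and variables $\mathcal{V}=\{v_i:i\in\mathbb{N}\}$. Terms are variables and constants (no function symbols). Formulas are defined as usual, except that void quantifiers are not allowed: $\forall xB$ and $\exists xB$ are formulas only if $x$ is free in $B$. $Form(\mathcal{S})$ and $Sent(\mathcal{S})$ are the sets of formulas and of sentences (closed formulas). $A(t/x)$ is the result of replacing every free occurrence of $x$ in $A$ by $t$. Two formulas are alphabetic variants if they differ only in (some of) their bound variables. **Natural deduction system $QLET_F$** (over sentences of $\mathcal{S}$; $c,c_1,c_2\in\mathcal{C}$; wherever $A(c/x)$ occurs, $A$ is a formula with no free variable other than $x$; square brackets mark discharged hypotheses): - $\land I$: from $A$, $B$ infer $A\land B$. $\land E$: from $A\land B$ infer $A$; from $A\land B$ infer $B$. - $\lor I$: from $A$ infer $A\lor B$; from $B$ infer $A\lor B$. $\lor E$: from $A\lor B$, a derivation of $C$ from $[A]$ and a derivation of $C$ from $[B]$, infer $C$. - $\neg\land I$: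 from $\neg A$ infer $\neg(A\land B)$; from $\neg B$ infer $\neg(A\land B)$. $\neg\land E$: from $\neg(A\land B)$, a derivation of $C$ from $[\neg A]$ and a derivation of $C$ from $[\neg B]$, infer $C$. - $\neg\lor I$: from $\neg A$, $\neg B$ infer $\neg(A\lor B)$. $\neg\lor E$: from $\neg(A\lor B)$ infer $\neg A$; from $\neg(A\lor B)$ infer $\neg B$. - $DN$: from $A$ infer $\neg\neg A$; from $\neg\neg A$ infer $A$. - $EXP^{\circ}$: from $\circ A$, $A$, $\neg A$ infer $B$. $PEM^{\circ}$: from $\circ A$ infer $A\lor\neg A$. - $Cons$: from $\circ A$, $\bullet A$ infer $B$. $Comp$: infer $\circ A\lor\bullet A$ from no premises. - $\forall I$: from $B\lor A(c/x)$ infer $B\lor\forall xA$, provided $c$ occurs neither in $A$ or $B$ nor in any hypothesis on which $B\lor A(c/x)$ depends. $\forall E$: from $\forall xA$ infer $A(c/x)$. - $\exists I$: from $A(c/x)$ infer $\exists xA$. $\exists E$: from $\exists xA$ and a derivation of $C$ from $[A(c/x)]$ infer $C$, provided $c$ occurs neither in $A$ or $C$ nor in any hypothesis on which $C$ depends, except $A(c/x)$. - $\neg\forall I$: from $\neg A(c/x)$ infer $\neg\forall xA$. $\neg\forall E$: from $\neg\forall xA$ and a derivation of $C$ from $[\neg A(c/x)]$ infer $C$, provided $c$ occurs neither in $A$ or $C$ nor in any hypothesis on which $C$ depends, except $\neg A(c/x)$. - $\neg\exists I$: from $\neg A(c/x)$ infer $\neg\exists xA$, provided $c$ occurs neither in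 $A$ nor in any hypothesis on which $\neg A(c/x)$ depends. $\neg\exists E$: from $\neg\exists xA$ infer $\neg A(c/x)$. - $\approx I$: infer $c\approx c$ from no premises. $\approx E$: from $c_1\approx c_2$ and $A(c_1/x)$ infer $A(c_2/x)$. - $AV$: from $A$ infer $A'$, for any alphabetic variant $A'$ of $A$. $\Gamma\vdash A$ (or $\Gamma\vdash_{\mathcal S}A$) means there is a (finite, tree-shaped) derivation of $A$ all of whose undischarged hypotheses belong to $\Gamma$. **Semantics.** An $\mathcal{S}$-structure is a pair $\mathfrak{A}=\langle\mathcal{D},\mathcal{I}\rangle$ with $\mathcal{D}\neq\emptyset$ such that $\mathcal{I}(c)=c^{\mathfrak{A}}\in\mathcal{D}$ for each $c\in\mathcal{C}$; each $n$-ary $P\in\mathcal{P}$ is assigned a pair $\langle P_+^{\mathfrak{A}},P_-^{\mathfrak{A}}\rangle$ with $P_+^{\mathfrak{A}}\cup P_-^{\mathfrak{A}}\subseteq\mathcal{D}^n$; and $\approx_+^{\mathfrak{A}}=\{\langle a,a\rangle:a\in\mathcal{D}\}$ (no constraint on $\approx_-^{\mathfrak A}$). The diagram signature $\mathcal{S}_{\mathfrak{A}}=\langle\mathcal{C}_{\mathfrak{A}},\mathcal{P}\rangle$ adds a new constant $\overline{a}$ for each $a\in\mathcal{D}$, i.e. $\mathcal{C}_{\mathfrak{A}}=\mathcal{C}\cup\{\overline{a}:a\in\mathcal{D}\}$; $\widehat{\mathfrak{A}}$ is the $\mathcal{S}_{\mathfrak{A}}$-structure that is just like $\mathfrak{A}$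 except that $\overline{a}^{\widehat{\mathfrak{A}}}=a$. A map $v:Sent(\mathcal{S}_{\mathfrak{A}})\to\{0,1\}$ is an $\mathfrak{A}$-valuation if: 1. $v(P(c_1,\dots,c_n))=1$ iff $\langle c_1^{\widehat{\mathfrak{A}}},\dots,c_n^{\widehat{\mathfrak{A}}}\rangle\in P_+^{\mathfrak{A}}$; 2. $v(\neg P(c_1,\dots,c_n))=1$ iff $\langle c_1^{\widehat{\mathfrak{A}}},\dots,c_n^{\widehat{\mathfrak{A}}}\rangle\in P_-^{\mathfrak{A}}$ (in 1 and 2, for all $c_1,\dots,c_n\in\mathcal{C}_{\mathfrak{A}}$); 3. $v(A\land B)=1$ iff $v(A)=1$ and $v(B)=1$; 4. $v(A\lor B)=1$ iff $v(A)=1$ or $v(B)=1$; 5. $v(\neg(A\land B))=1$ iff $v(\neg A)=1$ or $v(\neg B)=1$; 6. $v(\neg(A\lor B))=1$ iff $v(\neg A)=1$ and $v(\neg B)=1$; 7. $v(\neg\neg A)=1$ iff $v(A)=1$; 8. if $v(\circ A)=1$, then ($v(A)=1$ iff $v(\neg A)=0$); 9. $v(\circ A)=1$ iff $v(\bullet A)=0$; 10. $v(\forall xA)=1$ iff $v(A(\overline{a}/x))=1$ for every $a\in\mathcal{D}$; 11. $v(\exists xA)=1$ iff $v(A(\overline{a}/x))=1$ for some $a\in\mathcal{D}$; 12. $v(\neg\forall xA)=1$ iff $v(\neg A(\overline{a}/x))=1$ for some $a\in\mathcal{D}$; 13. $v(\neg\exists xA)=1$ iff $v(\neg A(\overline{a}/x))=1$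 for every $a\in\mathcal{D}$; 14. if $A'$ is an alphabetic variant of $A$, then $v(A')=v(A)$; 15. if $A\in Form(\mathcal{S}_{\mathfrak{A}})$ has no free variable other than $x$, $c_1,c_2\in\mathcal{C}_{\mathfrak{A}}$, $c_1^{\widehat{\mathfrak{A}}}=c_2^{\widehat{\mathfrak{A}}}$ and $v(A(c_1/x))=v(A(c_2/x))$, then $v(\#A(c_1/x))=v(\#A(c_2/x))$ for each $\#\in\{\neg,\circ,\bullet\}$. An $\mathcal{S}$-interpretation is a pair $\langle\mathfrak{A},v\rangle$ with $\mathfrak{A}$ an $\mathcal{S}$-structure and $v$ an $\mathfrak{A}$-valuation. $\mathfrak{A},v\vDash A$ means $v(A)=1$; $\mathfrak{A},v\vDash\Gamma$ means $v(B)=1$ for every $B\in\Gamma$. $\Gamma\vDash A$ means: for every $\mathcal{S}$-interpretation, $\mathfrak{A},v\vDash\Gamma$ implies $\mathfrak{A},v\vDash A$. *)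

theory Defs
  imports Main
begin

section \<open>Language\<close>

datatype 'c trm = Var nat | Const 'c

datatype (csts: 'c, prds: 'p) form =
    Atom 'p "'c trm list"
  | Neg "('c, 'p) form"  (\<open>\<^bold>\<not> _\<close> [80] 80)
  | Circ "('c, 'p) form"  (\<open>\<^bold>\<circ> _\<close> [80] 80)
  | Bul "('c, 'p) form"  (\<open>\<^bold>\<bullet> _\<close> [80] 80)
  | Conj "('c, 'p) form" "('c, 'p) form"  (infixr \<open>\<^bold>\<and>\<close> 75)
  | Disj "('c, 'p) form" "('c, 'p) form"  (infixr \<open>\<^bold>\<or>\<close> 70)
  | All nat "('c, 'p) form"
  | Ex nat "('c, 'p) form"

record ('c, 'p) signature =
  constants :: "'c set"
  predicates :: "'p set"
  arity :: "'p \<Rightarrow> nat"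
  ident :: 'p

definition is_signature :: "('c, 'p) signature \<Rightarrow> bool" where
  "is_signature S \<longleftrightarrow>
     infinite (constants S) \<and> ident S \<in> predicates S \<and> arity S (ident S) = 2"

primrec fv_trm :: "'c trm \<Rightarrow> nat set" where
  "fv_trm (Var x) = {x}"
| "fv_trm (Const c) = {}"

primrec fv :: "('c, 'p) form \<Rightarrow> nat set" where
  "fv (Atom P ts) = (\<Union>t \<in> set ts. fv_trm t)"
| "fv (\<^bold>\<not> A) = fv A"
| "fv (\<^bold>\<circ> A) = fv A"
| "fv (\<^bold>\<bullet> A) = fv A"
| "fv (A \<^bold>\<and> B) = fv A \<union> fv B"
| "fv (A \<^bold>\<or> B) = fv A \<union> fv B"
| "fv (All x A) = fv A - {x}"
| "fv (Ex x A) = fv A - {x}"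

text \<open>Well-formedness over a signature; the quantifier clauses exclude void quantifiers.\<close>

primrec wf_form :: "('c, 'p) signature \<Rightarrow> ('c, 'p) form \<Rightarrow> bool" where
  "wf_form S (Atom P ts) \<longleftrightarrow>
     P \<in> predicates S \<and> length ts = arity S P \<and> (\<forall>t \<in> set ts. set_trm t \<subseteq> constants S)"
| "wf_form S (\<^bold>\<not> A) \<longleftrightarrow> wf_form S A"
| "wf_form S (\<^bold>\<circ> A) \<longleftrightarrow> wf_form S A"
| "wf_form S (\<^bold>\<bullet> A) \<longleftrightarrow> wf_form S A"
| "wf_form S (A \<^bold>\<and> B) \<longleftrightarrow> wf_form S A \<and> wf_form S B"
| "wf_form S (A \<^bold>\<or> B) \<longleftrightarrow> wf_form S A \<and> wf_form S B"
| "wf_form S (All x A) \<longleftrightarrow> x \<in> fv A \<and> wf_form S A"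
| "wf_form S (Ex x A) \<longleftrightarrow> x \<in> fv A \<and> wf_form S A"

definition Form :: "('c, 'p) signature \<Rightarrow> ('c, 'p) form set" where
  "Form S = {A. wf_form S A}"

definition Sent :: "('c, 'p) signature \<Rightarrow> ('c, 'p) form set" where
  "Sent S = {A \<in> Form S. fv A = {}}"

primrec subst_trm :: "nat \<Rightarrow> 'c trm \<Rightarrow> 'c trm \<Rightarrow> 'c trm" where
  "subst_trm x t (Var y) = (if y = x then t else Var y)"
| "subst_trm x t (Const c) = Const c"

text \<open>
  Replacement of the free occurrences of a variable by a term. Bound variables are not renamed;
  below, only constants are substituted, so that no capture can occur.
\<close>

primrec subst :: "('c, 'p) form \<Rightarrow> 'c trm \<Rightarrow> nat \<Rightarrow> ('c, 'p) form"
    (\<open>_\<langle>_'/_\<rangle>\<close> [1000, 0, 0] 1000) where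
  "(Atom P ts)\<langle>t/x\<rangle> = Atom P (map (subst_trm x t) ts)"
| "(\<^bold>\<not> A)\<langle>t/x\<rangle> = \<^bold>\<not> A\<langle>t/x\<rangle>"
| "(\<^bold>\<circ> A)\<langle>t/x\<rangle> = \<^bold>\<circ> A\<langle>t/x\<rangle>"
| "(\<^bold>\<bullet> A)\<langle>t/x\<rangle> = \<^bold>\<bullet> A\<langle>t/x\<rangle>"
| "(A \<^bold>\<and> B)\<langle>t/x\<rangle> = A\<langle>t/x\<rangle> \<^bold>\<and> B\<langle>t/x\<rangle>"
| "(A \<^bold>\<or> B)\<langle>t/x\<rangle> = A\<langle>t/x\<rangle> \<^bold>\<or> B\<langle>t/x\<rangle>"
| "(All y A)\<langle>t/x\<rangle> = All y (if y = x then A else A\<langle>t/x\<rangle>)"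
| "(Ex y A)\<langle>t/x\<rangle> = Ex y (if y = x then A else A\<langle>t/x\<rangle>)"

text \<open>
  Alphabetic variants. The list records the pairs of variables bound so far at corresponding
  quantifiers, innermost first: two variable occurrences match if they are bound by corresponding
  quantifiers, or if both are free and equal.
\<close>

fun alpha_var :: "(nat \<times> nat) list \<Rightarrow> nat \<Rightarrow> nat \<Rightarrow> bool" where
  "alpha_var [] x y \<longleftrightarrow> x = y"
| "alpha_var ((a, b) # e) x y \<longleftrightarrow> x = a \<and> y = b \<or> x \<noteq> a \<and> y \<noteq> b \<and> alpha_var e x y"

fun alpha_trm :: "(nat \<times> nat) list \<Rightarrow> 'c trm \<Rightarrow> 'c trm \<Rightarrow> bool" where
  "alpha_trm e (Var x) (Var y) \<longleftrightarrow> alpha_var e x y"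
| "alpha_trm e (Const c) (Const d) \<longleftrightarrow> c = d"
| "alpha_trm e _ _ \<longleftrightarrow> False"

fun alpha :: "(nat \<times> nat) list \<Rightarrow> ('c, 'p) form \<Rightarrow> ('c, 'p) form \<Rightarrow> bool" where
  "alpha e (Atom P ts) (Atom Q us) \<longleftrightarrow> P = Q \<and> list_all2 (alpha_trm e) ts us"
| "alpha e (\<^bold>\<not> A) (\<^bold>\<not> A') \<longleftrightarrow> alpha e A A'"
| "alpha e (\<^bold>\<circ> A) (\<^bold>\<circ> A') \<longleftrightarrow> alpha e A A'"
| "alpha e (\<^bold>\<bullet> A) (\<^bold>\<bullet> A') \<longleftrightarrow> alpha e A A'"
| "alpha e (A \<^bold>\<and> B) (A' \<^bold>\<and> B') \<longleftrightarrow> alpha e A A' \<and> alpha e B B'"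
| "alpha e (A \<^bold>\<or> B) (A' \<^bold>\<or> B') \<longleftrightarrow> alpha e A A' \<and> alpha e B B'"
| "alpha e (All x A) (All y A') \<longleftrightarrow> alpha ((x, y) # e) A A'"
| "alpha e (Ex x A) (Ex y A') \<longleftrightarrow> alpha ((x, y) # e) A A'"
| "alpha e _ _ \<longleftrightarrow> False"

definition alphabetic_variant :: "('c, 'p) form \<Rightarrow> ('c, 'p) form \<Rightarrow> bool" where
  "alphabetic_variant A A' \<longleftrightarrow> alpha [] A A'"


section \<open>Natural deduction\<close>

text \<open>
  \<open>nd S H A\<close>: there is a derivation tree over the sentences of \<open>S\<close> with conclusion \<open>A\<close>
  whose set of undischarged hypotheses is exactly \<open>H\<close>. Discharging a hypothesis \<open>A\<close> is
  the operation \<open>H - {A}\<close>.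
\<close>

inductive nd :: "('c, 'p) signature \<Rightarrow> ('c, 'p) form set \<Rightarrow> ('c, 'p) form \<Rightarrow> bool"
  for S :: "('c, 'p) signature" where
  Hyp: "A \<in> Sent S \<Longrightarrow> nd S {A} A"
| ConjI: "nd S H1 A \<Longrightarrow> nd S H2 B \<Longrightarrow> nd S (H1 \<union> H2) (A \<^bold>\<and> B)"
| ConjE1: "nd S H (A \<^bold>\<and> B) \<Longrightarrow> nd S H A"
| ConjE2: "nd S H (A \<^bold>\<and> B) \<Longrightarrow> nd S H B"
| DisjI1: "nd S H A \<Longrightarrow> B \<in> Sent S \<Longrightarrow> nd S H (A \<^bold>\<or> B)"
| DisjI2: "nd S H B \<Longrightarrow> A \<in> Sent S \<Longrightarrow> nd S H (A \<^bold>\<or> B)"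
| DisjE: "nd S H (A \<^bold>\<or> B) \<Longrightarrow> nd S H1 C \<Longrightarrow> nd S H2 C \<Longrightarrow>
    nd S (H \<union> (H1 - {A}) \<union> (H2 - {B})) C"
| NegConjI1: "nd S H (\<^bold>\<not> A) \<Longrightarrow> B \<in> Sent S \<Longrightarrow> nd S H (\<^bold>\<not> (A \<^bold>\<and> B))"
| NegConjI2: "nd S H (\<^bold>\<not> B) \<Longrightarrow> A \<in> Sent S \<Longrightarrow> nd S H (\<^bold>\<not> (A \<^bold>\<and> B))"
| NegConjE: "nd S H (\<^bold>\<not> (A \<^bold>\<and> B)) \<Longrightarrow> nd S H1 C \<Longrightarrow> nd S H2 C \<Longrightarrow>
    nd S (H \<union> (H1 - {\<^bold>\<not> A}) \<union> (H2 - {\<^bold>\<not> B})) C"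
| NegDisjI: "nd S H1 (\<^bold>\<not> A) \<Longrightarrow> nd S H2 (\<^bold>\<not> B) \<Longrightarrow> nd S (H1 \<union> H2) (\<^bold>\<not> (A \<^bold>\<or> B))"
| NegDisjE1: "nd S H (\<^bold>\<not> (A \<^bold>\<or> B)) \<Longrightarrow> nd S H (\<^bold>\<not> A)"
| NegDisjE2: "nd S H (\<^bold>\<not> (A \<^bold>\<or> B)) \<Longrightarrow> nd S H (\<^bold>\<not> B)"
| DNI: "nd S H A \<Longrightarrow> nd S H (\<^bold>\<not> (\<^bold>\<not> A))"
| DNE: "nd S H (\<^bold>\<not> (\<^bold>\<not> A)) \<Longrightarrow> nd S H A"
| EXP: "nd S H1 (\<^bold>\<circ> A) \<Longrightarrow> nd S H2 A \<Longrightarrow> nd S H3 (\<^bold>\<not> A) \<Longrightarrow> B \<in> Sent S \<Longrightarrow>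
    nd S (H1 \<union> H2 \<union> H3) B"
| PEM: "nd S H (\<^bold>\<circ> A) \<Longrightarrow> nd S H (A \<^bold>\<or> \<^bold>\<not> A)"
| Cons: "nd S H1 (\<^bold>\<circ> A) \<Longrightarrow> nd S H2 (\<^bold>\<bullet> A) \<Longrightarrow> B \<in> Sent S \<Longrightarrow> nd S (H1 \<union> H2) B"
| Comp: "A \<in> Sent S \<Longrightarrow> nd S {} (\<^bold>\<circ> A \<^bold>\<or> \<^bold>\<bullet> A)"
| AllI: "nd S H (B \<^bold>\<or> A\<langle>Const c/x\<rangle>) \<Longrightarrow> All x A \<in> Sent S \<Longrightarrow> c \<in> constants S \<Longrightarrow>
    c \<notin> csts A \<union> csts B \<Longrightarrow> \<forall>D \<in> H. c \<notin> csts D \<Longrightarrow> nd S H (B \<^bold>\<or> All x A)"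
| AllE: "nd S H (All x A) \<Longrightarrow> c \<in> constants S \<Longrightarrow> nd S H (A\<langle>Const c/x\<rangle>)"
| ExI: "nd S H (A\<langle>Const c/x\<rangle>) \<Longrightarrow> c \<in> constants S \<Longrightarrow> Ex x A \<in> Sent S \<Longrightarrow> nd S H (Ex x A)"
| ExE: "nd S H (Ex x A) \<Longrightarrow> nd S H1 C \<Longrightarrow> c \<in> constants S \<Longrightarrow>
    c \<notin> csts A \<union> csts C \<Longrightarrow> \<forall>D \<in> H1 - {A\<langle>Const c/x\<rangle>}. c \<notin> csts D \<Longrightarrow>
    nd S (H \<union> (H1 - {A\<langle>Const c/x\<rangle>})) C"
| NegAllI: "nd S H (\<^bold>\<not> A\<langle>Const c/x\<rangle>) \<Longrightarrow> c \<in> constants S \<Longrightarrow> All x A \<in> Sent S \<Longrightarrow>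
    nd S H (\<^bold>\<not> (All x A))"
| NegAllE: "nd S H (\<^bold>\<not> (All x A)) \<Longrightarrow> nd S H1 C \<Longrightarrow> c \<in> constants S \<Longrightarrow>
    c \<notin> csts A \<union> csts C \<Longrightarrow> \<forall>D \<in> H1 - {\<^bold>\<not> A\<langle>Const c/x\<rangle>}. c \<notin> csts D \<Longrightarrow>
    nd S (H \<union> (H1 - {\<^bold>\<not> A\<langle>Const c/x\<rangle>})) C"
| NegExI: "nd S H (\<^bold>\<not> A\<langle>Const c/x\<rangle>) \<Longrightarrow> Ex x A \<in> Sent S \<Longrightarrow> c \<in> constants S \<Longrightarrow>
    c \<notin> csts A \<Longrightarrow> \<forall>D \<in> H. c \<notin> csts D \<Longrightarrow> nd S H (\<^bold>\<not> (Ex x A))"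
| NegExE: "nd S H (\<^bold>\<not> (Ex x A)) \<Longrightarrow> c \<in> constants S \<Longrightarrow> nd S H (\<^bold>\<not> A\<langle>Const c/x\<rangle>)"
| IdI: "c \<in> constants S \<Longrightarrow> nd S {} (Atom (ident S) [Const c, Const c])"
| IdE: "nd S H1 (Atom (ident S) [Const c1, Const c2]) \<Longrightarrow> nd S H2 (A\<langle>Const c1/x\<rangle>) \<Longrightarrow>
    A \<in> Form S \<Longrightarrow> fv A \<subseteq> {x} \<Longrightarrow> nd S (H1 \<union> H2) (A\<langle>Const c2/x\<rangle>)"
| AV: "nd S H A \<Longrightarrow> alphabetic_variant A A' \<Longrightarrow> A' \<in> Sent S \<Longrightarrow> nd S H A'"

definition provable :: "('c, 'p) signature \<Rightarrow> ('c, 'p) form set \<Rightarrow> ('c, 'p) form \<Rightarrow> bool" where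
  "provable S \<Gamma> A \<longleftrightarrow> (\<exists>H. H \<subseteq> \<Gamma> \<and> nd S H A)"


section \<open>Semantics\<close>

text \<open>The fields \<open>pos\<close> and \<open>neg\<close> are the extensions \<open>P\<^sub>+\<close> and \<open>P\<^sub>-\<close>; tuples are lists.\<close>

record ('c, 'p, 'd) struct =
  domain :: "'d set"
  interp :: "'c \<Rightarrow> 'd"
  pos :: "'p \<Rightarrow> 'd list set"
  neg :: "'p \<Rightarrow> 'd list set"

definition is_struct :: "('c, 'p) signature \<Rightarrow> ('c, 'p, 'd) struct \<Rightarrow> bool" where
  "is_struct S M \<longleftrightarrow>
     domain M \<noteq> {} \<and>
     (\<forall>c \<in> constants S. interp M c \<in> domain M) \<and>
     (\<forall>P \<in> predicates S.
        pos M P \<union> neg M P \<subseteq> {as. length as = arity S P \<and> set as \<subseteq> domain M}) \<and>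
     pos M (ident S) = {[a, a] | a. a \<in> domain M}"

text \<open>In the diagram signature, \<open>Inl c\<close> is the old constant \<open>c\<close> and \<open>Inr a\<close> the name of \<open>a\<close>.\<close>

definition diagram_sig ::
  "('c, 'p) signature \<Rightarrow> ('c, 'p, 'd) struct \<Rightarrow> ('c + 'd, 'p) signature" where
  "diagram_sig S M =
     \<lparr>constants = Inl ` constants S \<union> Inr ` domain M, predicates = predicates S,
      arity = arity S, ident = ident S\<rparr>"

definition diagram_struct :: "('c, 'p, 'd) struct \<Rightarrow> ('c + 'd, 'p, 'd) struct" where
  "diagram_struct M =
     \<lparr>domain = domain M, interp = case_sum (interp M) (\<lambda>a. a), pos = pos M, neg = neg M\<rparr>"

abbreviation embed :: "('c, 'p) form \<Rightarrow> ('c + 'd, 'p) form" where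
  "embed \<equiv> map_form Inl id"

text \<open>
  \<open>v A\<close> stands for \<open>v(A) = 1\<close> and \<open>\<not> v A\<close> for \<open>v(A) = 0\<close>. Values of \<open>v\<close> outside the sentences of
  the diagram signature are irrelevant.
\<close>

locale valuation =
  fixes S :: "('c, 'p) signature"
    and M :: "('c, 'p, 'd) struct"
    and v :: "('c + 'd, 'p) form \<Rightarrow> bool"
  assumes atom: "\<lbrakk>P \<in> predicates S; length cs = arity S P; set cs \<subseteq> constants (diagram_sig S M)\<rbrakk> \<Longrightarrow>
      v (Atom P (map Const cs)) \<longleftrightarrow> map (interp (diagram_struct M)) cs \<in> pos M P"
    and neg_atom: "\<lbrakk>P \<in> predicates S; length cs = arity S P; set cs \<subseteq> constants (diagram_sig S M)\<rbrakk> \<Longrightarrow>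
      v (\<^bold>\<not> (Atom P (map Const cs))) \<longleftrightarrow> map (interp (diagram_struct M)) cs \<in> neg M P"
    and conj: "\<lbrakk>A \<in> Sent (diagram_sig S M); B \<in> Sent (diagram_sig S M)\<rbrakk> \<Longrightarrow>
      v (A \<^bold>\<and> B) \<longleftrightarrow> v A \<and> v B"
    and disj: "\<lbrakk>A \<in> Sent (diagram_sig S M); B \<in> Sent (diagram_sig S M)\<rbrakk> \<Longrightarrow>
      v (A \<^bold>\<or> B) \<longleftrightarrow> v A \<or> v B"
    and neg_conj: "\<lbrakk>A \<in> Sent (diagram_sig S M); B \<in> Sent (diagram_sig S M)\<rbrakk> \<Longrightarrow>
      v (\<^bold>\<not> (A \<^bold>\<and> B)) \<longleftrightarrow> v (\<^bold>\<not> A) \<or> v (\<^bold>\<not> B)"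
    and neg_disj: "\<lbrakk>A \<in> Sent (diagram_sig S M); B \<in> Sent (diagram_sig S M)\<rbrakk> \<Longrightarrow>
      v (\<^bold>\<not> (A \<^bold>\<or> B)) \<longleftrightarrow> v (\<^bold>\<not> A) \<and> v (\<^bold>\<not> B)"
    and neg_neg: "A \<in> Sent (diagram_sig S M) \<Longrightarrow> v (\<^bold>\<not> (\<^bold>\<not> A)) \<longleftrightarrow> v A"
    and circ: "\<lbrakk>A \<in> Sent (diagram_sig S M); v (\<^bold>\<circ> A)\<rbrakk> \<Longrightarrow> v A \<longleftrightarrow> \<not> v (\<^bold>\<not> A)"
    and circ_bul: "A \<in> Sent (diagram_sig S M) \<Longrightarrow> v (\<^bold>\<circ> A) \<longleftrightarrow> \<not> v (\<^bold>\<bullet> A)"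
    and all: "All x A \<in> Sent (diagram_sig S M) \<Longrightarrow>
      v (All x A) \<longleftrightarrow> (\<forall>a \<in> domain M. v (A\<langle>Const (Inr a)/x\<rangle>))"
    and ex: "Ex x A \<in> Sent (diagram_sig S M) \<Longrightarrow>
      v (Ex x A) \<longleftrightarrow> (\<exists>a \<in> domain M. v (A\<langle>Const (Inr a)/x\<rangle>))"
    and neg_all: "All x A \<in> Sent (diagram_sig S M) \<Longrightarrow>
      v (\<^bold>\<not> (All x A)) \<longleftrightarrow> (\<exists>a \<in> domain M. v (\<^bold>\<not> A\<langle>Const (Inr a)/x\<rangle>))"
    and neg_ex: "Ex x A \<in> Sent (diagram_sig S M) \<Longrightarrow>
      v (\<^bold>\<not> (Ex x A)) \<longleftrightarrow> (\<forall>a \<in> domain M. v (\<^bold>\<not> A\<langle>Const (Inr a)/x\<rangle>))"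
    and variant: "\<lbrakk>A \<in> Sent (diagram_sig S M); A' \<in> Sent (diagram_sig S M);
        alphabetic_variant A A'\<rbrakk> \<Longrightarrow> v A' \<longleftrightarrow> v A"
    and congr: "\<lbrakk>A \<in> Form (diagram_sig S M); fv A \<subseteq> {x};
        c1 \<in> constants (diagram_sig S M); c2 \<in> constants (diagram_sig S M);
        interp (diagram_struct M) c1 = interp (diagram_struct M) c2;
        v (A\<langle>Const c1/x\<rangle>) \<longleftrightarrow> v (A\<langle>Const c2/x\<rangle>); op \<in> {Neg, Circ, Bul}\<rbrakk> \<Longrightarrow>
      v (op (A\<langle>Const c1/x\<rangle>)) \<longleftrightarrow> v (op (A\<langle>Const c2/x\<rangle>))"

text \<open>
  Semantic consequence with respect to the structures whose domain is a set of elements of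
  the type \<open>'d\<close>. Consequence over arbitrary domains implies consequence in this sense for every
  \<open>'d\<close>; for the converse \<open>'d\<close> has to be large enough, and \<open>('c, 'p) form\<close> is, because it has at
  least as many elements as there are sentences of the signature.
\<close>

definition consequence ::
  "'d itself \<Rightarrow> ('c, 'p) signature \<Rightarrow> ('c, 'p) form set \<Rightarrow> ('c, 'p) form \<Rightarrow> bool" where
  "consequence _ S \<Gamma> A \<longleftrightarrow>
     (\<forall>(M :: ('c, 'p, 'd) struct) v. is_struct S M \<and> valuation S M v \<longrightarrow>
        (\<forall>B \<in> \<Gamma>. v (embed B)) \<longrightarrow> v (embed A))"

end

theory Submission
  imports Defs
begin

text \<open>
  Henkin's method, for a constant-domain logic without implication. The language is extended by a
  witnessing constant for every existential sentence and a counterexample constant for every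
  universal one, and derivability is strengthened by the corresponding Henkin implications. Finitely
  many such implications can be eliminated again by \<open>\<exists>E\<close> and by the disjunctive form of \<open>\<forall>I\<close>, so a
  theory maximal among those not deriving \<open>A\<close> is prime and has witnesses of both kinds. The negated
  quantifiers need no witnesses of their own, because \<open>\<not>\<forall>xB\<close> and \<open>\<not>\<exists>xB\<close> are interderivable with
  \<open>\<exists>x\<not>B\<close> and \<open>\<forall>x\<not>B\<close>. Truth in the canonical model is membership in the theory, after replacing each
  constant by a representative of its class under provable identity. Nothing is enumerated, hence
  signatures of arbitrary cardinality are covered.
\<close>

section \<open>Substitution and renaming of constants\<close>

abbreviation rename :: "('c \<Rightarrow> 'd) \<Rightarrow> ('c, 'p) form \<Rightarrow> ('d, 'p) form" where
  "rename f \<equiv> map_form f id"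

lemma fv_subst_trm: "fv_trm (subst_trm x (Const c) t) = fv_trm t - {x}"
  by (cases t) auto

lemma fv_subst [simp]: "fv (A\<langle>Const c/x\<rangle>) = fv A - {x}"
  by (induction A) (auto simp: fv_subst_trm)

lemma set_subst_trm: "set_trm (subst_trm x (Const c) t) \<subseteq> insert c (set_trm t)"
  by (cases t) auto

lemma csts_subst: "csts (A\<langle>Const c/x\<rangle>) \<subseteq> insert c (csts A)"
  by (induction A) (auto dest: set_subst_trm[THEN subsetD])

lemma wf_form_subst: "c \<in> constants S \<Longrightarrow> wf_form S A \<Longrightarrow> wf_form S (A\<langle>Const c/x\<rangle>)"
  by (induction A) (auto dest!: set_subst_trm[THEN subsetD])

lemma Sent_subst:
  assumes "c \<in> constants S" "wf_form S A" "fv A \<subseteq> {x}"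
  shows "A\<langle>Const c/x\<rangle> \<in> Sent S"
  using assms wf_form_subst[of c S A x] by (auto simp: Sent_def Form_def)

lemma finite_csts [simp]: "finite (csts A)"
proof -
  have "finite (set_trm t)" for t :: "'a trm"
    by (cases t) auto
  then show ?thesis
    by (induction A) simp_all
qed

lemma csts_wf_form: "wf_form S A \<Longrightarrow> csts A \<subseteq> constants S"
  by (induction A) auto

lemma csts_Sent: "A \<in> Sent S \<Longrightarrow> csts A \<subseteq> constants S"
  by (auto simp: Sent_def Form_def dest: csts_wf_form)

lemma fv_rename [simp]: "fv (rename f A) = fv A"
proof -
  have "fv_trm (map_trm f t) = fv_trm t" for t
    by (cases t) auto
  then show ?thesis
    by (induction A) auto
qed

lemma rename_subst [simp]: "rename f (A\<langle>Const c/x\<rangle>) = (rename f A)\<langle>Const (f c)/x\<rangle>"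
proof -
  have "map_trm f (subst_trm x (Const c) t) = subst_trm x (Const (f c)) (map_trm f t)" for t
    by (cases t) auto
  then show ?thesis
    by (induction A) auto
qed

lemma wf_form_rename:
  assumes "wf_form S A" "predicates S' = predicates S" "arity S' = arity S"
    "f ` csts A \<subseteq> constants S'"
  shows "wf_form S' (rename f A)"
  using assms by (induction A) (auto simp: trm.set_map)

lemma Sent_rename:
  assumes "A \<in> Sent S" "predicates S' = predicates S" "arity S' = arity S"
    "f ` csts A \<subseteq> constants S'"
  shows "rename f A \<in> Sent S'"
  using assms wf_form_rename[of S A S' f] by (simp add: Sent_def Form_def)

section \<open>Alphabetic variants: symmetry and stability under renaming of constants\<close>

lemma alpha_trm_map: "alpha_trm e t u \<Longrightarrow> alpha_trm e (map_trm f t) (map_trm f u)"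
  by (cases t; cases u) auto

lemma alpha_rename: "alpha e A B \<Longrightarrow> alpha e (rename f A) (rename f B)"
proof (induction A arbitrary: e B)
  case (Atom P ts)
  then show ?case
    by (cases B) (auto simp: list_all2_conv_all_nth alpha_trm_map)
next
  case (Neg A)
  then show ?case by (cases B) auto
next
  case (Circ A)
  then show ?case by (cases B) auto
next
  case (Bul A)
  then show ?case by (cases B) auto
next
  case (Conj A1 A2)
  then show ?case by (cases B) auto
next
  case (Disj A1 A2)
  then show ?case by (cases B) auto
next
  case (All x A)
  then show ?case by (cases B) auto
next
  case (Ex x A)
  then show ?case by (cases B) auto
qed

lemma alpha_var_sym: "alpha_var e x y \<Longrightarrow> alpha_var (map prod.swap e) y x"
  by (induction e x y rule: alpha_var.induct) auto

lemma alpha_trm_sym: "alpha_trm e t u \<Longrightarrow> alpha_trm (map prod.swap e) u t"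
  by (cases t; cases u) (simp_all add: alpha_var_sym)

text \<open>The induction needs an arbitrary environment because every quantifier pushes a pair;
  exchanging the two formulas exchanges the components of each pair.\<close>

lemma alpha_sym: "alpha e A B \<Longrightarrow> alpha (map prod.swap e) B A"
proof (induction A arbitrary: e B)
  case (Atom P ts)
  then show ?case
    by (cases B) (auto simp: list_all2_conv_all_nth alpha_trm_sym)
next
  case (Neg A)
  then show ?case by (cases B) auto
next
  case (Circ A)
  then show ?case by (cases B) auto
next
  case (Bul A)
  then show ?case by (cases B) auto
next
  case (Conj A1 A2)
  then show ?case by (cases B) auto
next
  case (Disj A1 A2)
  then show ?case by (cases B) auto
next
  case (All x A)
  then obtain y A' where "B = All y A'" "alpha ((x, y) # e) A A'"
    by (cases B) auto
  then show ?case
    using All.IH[of "(x, y) # e" A'] by simp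
next
  case (Ex x A)
  then obtain y A' where "B = Ex y A'" "alpha ((x, y) # e) A A'"
    by (cases B) auto
  then show ?case
    using Ex.IH[of "(x, y) # e" A'] by simp
qed

lemma alphabetic_variant_sym: "alphabetic_variant A B \<Longrightarrow> alphabetic_variant B A"
  unfolding alphabetic_variant_def using alpha_sym[of "[]" A B] by simp

lemma alphabetic_variant_rename:
  "alphabetic_variant A B \<Longrightarrow> alphabetic_variant (rename f A) (rename f B)"
  unfolding alphabetic_variant_def by (rule alpha_rename)

lemma rename_inj:
  assumes "inj_on f K" "csts A \<subseteq> K" "csts B \<subseteq> K" "rename f A = rename f B"
  shows "A = B"
proof (rule form.inj_map_strong[OF _ _ assms(4)])
  show "c = d" if "c \<in> csts A" "d \<in> csts B" "f c = f d" for c d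
    using that assms(1-3) by (meson inj_onD subsetD)
qed simp

text \<open>Discharge is set difference, which an image respects only if no other hypothesis
  collapses onto the discharged one. Injectivity on the constants involved excludes this.\<close>

lemma rename_diff:
  assumes "inj_on f K" "\<Union>(csts ` H) \<subseteq> K" "csts A \<subseteq> K"
  shows "rename f ` (H - {A}) = rename f ` H - {rename f A}"
proof -
  have "B = A" if "B \<in> H" "rename f B = rename f A" for B
  proof (rule rename_inj[OF assms(1) _ assms(3) that(2)])
    show "csts B \<subseteq> K"
      using that(1) assms(2) by blast
  qed
  then show ?thesis
    by auto
qed

section \<open>Derivability\<close>

lemma Sent_simps [simp]:
  "\<^bold>\<not> A \<in> Sent S \<longleftrightarrow> A \<in> Sent S"
  "\<^bold>\<circ> A \<in> Sent S \<longleftrightarrow> A \<in> Sent S"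
  "\<^bold>\<bullet> A \<in> Sent S \<longleftrightarrow> A \<in> Sent S"
  "A \<^bold>\<and> B \<in> Sent S \<longleftrightarrow> A \<in> Sent S \<and> B \<in> Sent S"
  "A \<^bold>\<or> B \<in> Sent S \<longleftrightarrow> A \<in> Sent S \<and> B \<in> Sent S"
  by (auto simp: Sent_def Form_def)

lemma Sent_instance:
  assumes "All x A \<in> Sent S \<or> Ex x A \<in> Sent S" "c \<in> constants S"
  shows "A\<langle>Const c/x\<rangle> \<in> Sent S"
proof (rule Sent_subst)
  show "wf_form S A" "fv A \<subseteq> {x}"
    using assms(1) by (force simp: Sent_def Form_def)+
qed fact

lemma ident_Sent:
  "is_signature S \<Longrightarrow>
    Atom (ident S) [Const c, Const d] \<in> Sent S \<longleftrightarrow> c \<in> constants S \<and> d \<in> constants S"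
  by (simp add: Sent_def Form_def is_signature_def)

lemma nd_Sent:
  assumes "is_signature S" "nd S H A"
  shows "finite H \<and> H \<subseteq> Sent S \<and> A \<in> Sent S"
  using assms(2)
proof induction
  case (IdE H1 c1 c2 H2 A x)
  then show ?case
    using assms(1) by (simp add: ident_Sent Form_def Sent_subst)
qed (use assms(1) in \<open>auto simp: ident_Sent Sent_instance\<close>)

lemma provable_Sent: "is_signature S \<Longrightarrow> provable S X A \<Longrightarrow> A \<in> Sent S"
  by (auto simp: provable_def dest: nd_Sent)

lemma provable_hyp: "A \<in> X \<Longrightarrow> A \<in> Sent S \<Longrightarrow> provable S X A"
  unfolding provable_def by (rule exI[of _ "{A}"]) (auto intro: Hyp)

lemma provable_mono: "provable S X A \<Longrightarrow> X \<subseteq> Y \<Longrightarrow> provable S Y A"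
  unfolding provable_def by blast

lemma provable_rule:
  "provable S X A \<Longrightarrow> (\<And>H. nd S H A \<Longrightarrow> nd S H B) \<Longrightarrow> provable S X B"
  unfolding provable_def by blast

lemma provable_disjE:
  assumes "provable S X (A \<^bold>\<or> B)" "provable S (insert A X) C" "provable S (insert B X) C"
  shows "provable S X C"
proof -
  obtain H H1 H2 where "nd S H (A \<^bold>\<or> B)" "nd S H1 C" "nd S H2 C"
    and "H \<subseteq> X" "H1 \<subseteq> insert A X" "H2 \<subseteq> insert B X"
    using assms unfolding provable_def by blast
  then show ?thesis
    unfolding provable_def
    by (intro exI[of _ "H \<union> (H1 - {A}) \<union> (H2 - {B})"] conjI DisjE) auto
qed

lemma provable_disjI1: "provable S X A \<Longrightarrow> B \<in> Sent S \<Longrightarrow> provable S X (A \<^bold>\<or> B)"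
  by (erule provable_rule) (rule DisjI1)

lemma provable_disjI2: "provable S X B \<Longrightarrow> A \<in> Sent S \<Longrightarrow> provable S X (A \<^bold>\<or> B)"
  by (erule provable_rule) (rule DisjI2)

text \<open>In the absence of implication, cut is a case distinction on the disjunction of
  \<open>A\<close> with itself.\<close>

lemma provable_cut:
  assumes "is_signature S" "provable S X A" "provable S (insert A X) C"
  shows "provable S X C"
  using assms by (meson provable_disjE provable_disjI1 provable_Sent)

section \<open>Renaming the constants of a derivation\<close>

lemma csts_rename [simp]: "csts (rename f A) = f ` csts A"
  by (simp add: form.set_map)

text \<open>
  The renaming only has to be injective on the finitely many constants of a derivation, so the
  target signature may have fewer constants than the source.
\<close>

lemma nd_rename:
  fixes S' :: "('k, 'p) signature" and S :: "('c, 'p) signature"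
  assumes sig: "is_signature S'" and "nd S' H A"
    and S: "predicates S = predicates S'" "arity S = arity S'" "ident S = ident S'"
  shows "\<exists>K. finite K \<and> K \<subseteq> constants S' \<and>
    (\<forall>f. inj_on f K \<and> f ` K \<subseteq> constants S \<longrightarrow> nd S (rename f ` H) (rename f A))"
proof -
  define ok :: "('k \<Rightarrow> 'c) \<Rightarrow> 'k set \<Rightarrow> bool" where
    "ok f K \<longleftrightarrow> inj_on f K \<and> f ` K \<subseteq> constants S" for f K
  define Q :: "('k, 'p) form set \<Rightarrow> ('k, 'p) form \<Rightarrow> bool" where "Q H A \<longleftrightarrow> (\<exists>K. finite K \<and> K \<subseteq> constants S' \<and>
    (\<forall>f. ok f K \<longrightarrow> nd S (rename f ` H) (rename f A)))" for H A
  define good :: "('k \<Rightarrow> 'c) \<Rightarrow> 'k set \<Rightarrow> ('k, 'p) form set \<times> ('k, 'p) form \<Rightarrow> bool"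
    where "good f K p \<longleftrightarrow> nd S (rename f ` fst p) (rename f (snd p)) \<and>
    \<Union>(csts ` fst p) \<subseteq> K \<and> csts (snd p) \<subseteq> K" for f K p
  \<comment> \<open>A uniform treatment of all rules: \<open>ps\<close> lists the premises and
    \<open>L\<close> further constants that the rule mentions. The finite sets belonging to the
    premises are united with \<open>L\<close>, so that one map, injective on the union, serves every
    premise.\<close>
  have step: "Q H A"
    if prem: "\<forall>p \<in> set ps. nd S' (fst p) (snd p) \<and> Q (fst p) (snd p)"
      and L: "finite L" "L \<subseteq> constants S'"
      and rule: "\<And>f K. ok f K \<Longrightarrow> L \<subseteq> K \<Longrightarrow> \<forall>p \<in> set ps. good f K p \<Longrightarrow>
        nd S (rename f ` H) (rename f A)"
    for H A ps L
  proof -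
    have "\<exists>K. finite K \<and> K \<subseteq> constants S' \<and> (\<forall>K' f. K \<subseteq> K' \<longrightarrow> ok f K' \<longrightarrow> good f K' p)"
      if p: "p \<in> set ps" for p
    proof -
      obtain K where K: "finite K" "K \<subseteq> constants S'"
        "\<And>f. ok f K \<Longrightarrow> nd S (rename f ` fst p) (rename f (snd p))"
        using prem p unfolding Q_def by blast
      \<comment> \<open>All constants of the premise are included, so that both freshness conditions
        and discharges survive the renaming.\<close>
      let ?K = "K \<union> \<Union>(csts ` fst p) \<union> csts (snd p)"
      have p': "finite (fst p)" "fst p \<subseteq> Sent S'" "snd p \<in> Sent S'"
        using prem p nd_Sent[OF sig] by blast+
      show ?thesis
      proof (intro exI[of _ ?K] conjI allI impI)
        show "finite ?K"
          using K(1) p'(1) by simp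
        show "?K \<subseteq> constants S'"
          using K(2) p'(2,3) csts_Sent by blast
      next
        fix K' f
        assume K': "?K \<subseteq> K'" and "ok f K'"
        then have "ok f K"
          by (auto simp: ok_def intro: inj_on_subset)
        then show "good f K' p"
          using K(3) K' by (simp add: good_def)
      qed
    qed
    then obtain k where k: "finite (k p) \<and> k p \<subseteq> constants S' \<and>
      (\<forall>K' f. k p \<subseteq> K' \<longrightarrow> ok f K' \<longrightarrow> good f K' p)" if "p \<in> set ps" for p
      by metis
    let ?K = "L \<union> (\<Union>p \<in> set ps. k p)"
    have "nd S (rename f ` H) (rename f A)" if "ok f ?K" for f
    proof (rule rule[OF that])
      show "\<forall>p \<in> set ps. good f ?K p"
      proof
        fix p
        assume p: "p \<in> set ps"
        then have "k p \<subseteq> ?K"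
          by blast
        then show "good f ?K p"
          using k[OF p] that by blast
      qed
    qed auto
    moreover have "finite ?K" "?K \<subseteq> constants S'"
      using L k by auto
    ultimately show ?thesis
      unfolding Q_def by blast
  qed
  have Sent: "rename f B \<in> Sent S" if "ok f K" "B \<in> Sent S'" "csts B \<subseteq> K" for f K B
    using that by (intro Sent_rename[OF that(2)] S) (auto simp: ok_def)
  have mem: "f c \<in> constants S" if "ok f K" "c \<in> K" for f K c
    using that by (auto simp: ok_def)
  \<comment> \<open>Injectivity preserves the side conditions on eigenconstants in both
    directions.\<close>
  have fresh: "f c \<in> f ` csts B \<longleftrightarrow> c \<in> csts B" if "ok f K" "c \<in> K" "csts B \<subseteq> K" for f c K B
    using that inj_on_image_mem_iff[of f K c "csts B"] by (simp add: ok_def)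
  have diff: "rename f ` (H - {B}) = rename f ` H - {rename f B}"
    if "ok f K" "\<Union>(csts ` H) \<subseteq> K" "csts B \<subseteq> K" for f K H B
    using that by (intro rename_diff[of f K]) (auto simp only: ok_def)
  from \<open>nd S' H A\<close> have "Q H A"
  proof induction
    case (Hyp A)
    show ?case
    proof (rule step[where ps = "[]" and L = "csts A"])
      fix f K
      assume "ok f K" "csts A \<subseteq> K"
      then show "nd S (rename f ` {A}) (rename f A)"
        using Sent Hyp by (simp add: nd.Hyp)
    qed (use Hyp csts_Sent in auto)
  next
    case (ConjI H1 A H2 B)
    show ?case
      by (rule step[where ps = "[(H1, A), (H2, B)]" and L = "{}"])
        (use ConjI in \<open>auto simp: good_def image_Un intro: nd.ConjI\<close>)
  next
    case (ConjE1 H A B)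
    show ?case
      by (rule step[where ps = "[(H, A \<^bold>\<and> B)]" and L = "{}"])
        (use ConjE1 in \<open>auto simp: good_def intro: nd.ConjE1\<close>)
  next
    case (ConjE2 H A B)
    show ?case
      by (rule step[where ps = "[(H, A \<^bold>\<and> B)]" and L = "{}"])
        (use ConjE2 in \<open>auto simp: good_def intro: nd.ConjE2\<close>)
  next
    case (DisjI1 H A B)
    show ?case
      by (rule step[where ps = "[(H, A)]" and L = "csts B"])
        (use DisjI1 csts_Sent in \<open>auto simp: good_def intro!: nd.DisjI1 Sent\<close>)
  next
    case (DisjI2 H B A)
    show ?case
      by (rule step[where ps = "[(H, B)]" and L = "csts A"])
        (use DisjI2 csts_Sent in \<open>auto simp: good_def intro!: nd.DisjI2 Sent\<close>)
  next
    case (DisjE H A B H1 C H2)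
    show ?case
    proof (rule step[where ps = "[(H, A \<^bold>\<or> B), (H1, C), (H2, C)]" and L = "{}"])
      fix f K
      assume K: "ok f K" and
        "\<forall>p \<in> set [(H, A \<^bold>\<or> B), (H1, C), (H2, C)]. good f K p"
      note * = this(2)[unfolded good_def, simplified]
      show "nd S (rename f ` (H \<union> (H1 - {A}) \<union> (H2 - {B}))) (rename f C)"
        unfolding image_Un using * by (subst (1 2) diff[OF K]) (auto intro!: nd.DisjE)
    qed (use DisjE in auto)
  next
    case (NegConjI1 H A B)
    show ?case
      by (rule step[where ps = "[(H, \<^bold>\<not> A)]" and L = "csts B"])
        (use NegConjI1 csts_Sent in \<open>auto simp: good_def intro!: nd.NegConjI1 Sent\<close>)
  next
    case (NegConjI2 H B A)
    show ?case
      by (rule step[where ps = "[(H, \<^bold>\<not> B)]" and L = "csts A"])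
        (use NegConjI2 csts_Sent in \<open>auto simp: good_def intro!: nd.NegConjI2 Sent\<close>)
  next
    case (NegConjE H A B H1 C H2)
    show ?case
    proof (rule step[where ps = "[(H, \<^bold>\<not> (A \<^bold>\<and> B)), (H1, C), (H2, C)]" and L = "{}"])
      fix f K
      assume K: "ok f K" and
        "\<forall>p \<in> set [(H, \<^bold>\<not> (A \<^bold>\<and> B)), (H1, C), (H2, C)]. good f K p"
      note * = this(2)[unfolded good_def, simplified]
      show "nd S (rename f ` (H \<union> (H1 - {\<^bold>\<not> A}) \<union> (H2 - {\<^bold>\<not> B}))) (rename f C)"
        unfolding image_Un using * by (subst (1 2) diff[OF K]) (auto intro!: nd.NegConjE)
    qed (use NegConjE in auto)
  next
    case (NegDisjI H1 A H2 B)
    show ?case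
      by (rule step[where ps = "[(H1, \<^bold>\<not> A), (H2, \<^bold>\<not> B)]" and L = "{}"])
        (use NegDisjI in \<open>auto simp: good_def image_Un intro: nd.NegDisjI\<close>)
  next
    case (NegDisjE1 H A B)
    show ?case
      by (rule step[where ps = "[(H, \<^bold>\<not> (A \<^bold>\<or> B))]" and L = "{}"])
        (use NegDisjE1 in \<open>auto simp: good_def intro: nd.NegDisjE1\<close>)
  next
    case (NegDisjE2 H A B)
    show ?case
      by (rule step[where ps = "[(H, \<^bold>\<not> (A \<^bold>\<or> B))]" and L = "{}"])
        (use NegDisjE2 in \<open>auto simp: good_def intro: nd.NegDisjE2\<close>)
  next
    case (DNI H A)
    show ?case
      by (rule step[where ps = "[(H, A)]" and L = "{}"]) (use DNI in \<open>auto simp: good_def intro: nd.DNI\<close>)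
  next
    case (DNE H A)
    show ?case
      by (rule step[where ps = "[(H, \<^bold>\<not> (\<^bold>\<not> A))]" and L = "{}"]) (use DNE in \<open>auto simp: good_def intro: nd.DNE\<close>)
  next
    case (EXP H1 A H2 H3 B)
    show ?case
      by (rule step[where ps = "[(H1, \<^bold>\<circ> A), (H2, A), (H3, \<^bold>\<not> A)]" and L = "csts B"])
        (use EXP csts_Sent in \<open>auto simp: good_def image_Un intro!: nd.EXP[where A = "rename _ A"] Sent\<close>)
  next
    case (PEM H A)
    show ?case
      by (rule step[where ps = "[(H, \<^bold>\<circ> A)]" and L = "{}"]) (use PEM in \<open>auto simp: good_def intro: nd.PEM\<close>)
  next
    case (Cons H1 A H2 B)
    show ?case
      by (rule step[where ps = "[(H1, \<^bold>\<circ> A), (H2, \<^bold>\<bullet> A)]" and L = "csts B"])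
        (use Cons csts_Sent in \<open>auto simp: good_def image_Un intro!: nd.Cons[where A = "rename _ A"] Sent\<close>)
  next
    case (Comp A)
    show ?case
      by (rule step[where ps = "[]" and L = "csts A"])
        (use Comp csts_Sent in \<open>auto simp: good_def intro!: nd.Comp Sent\<close>)
  next
    case (AllI H B A c x)
    show ?case
    proof (rule step[where ps = "[(H, B \<^bold>\<or> A\<langle>Const c/x\<rangle>)]" and L = "insert c (csts A)"])
      fix f K
      assume K: "ok f K" "insert c (csts A) \<subseteq> K" and
        "\<forall>p \<in> set [(H, B \<^bold>\<or> A\<langle>Const c/x\<rangle>)]. good f K p"
      note * = this(3)[unfolded good_def, simplified]
      have "nd S (rename f ` H) (rename f B \<^bold>\<or> All x (rename f A))"
      proof (rule nd.AllI[where c = "f c"])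
        show "All x (rename f A) \<in> Sent S"
          using Sent[OF K(1) AllI.hyps(2)] K(2) by simp
      qed (use * K AllI in \<open>simp_all add: mem fresh[OF K(1)] UN_subset_iff\<close>)
      then show "nd S (rename f ` H) (rename f (B \<^bold>\<or> All x A))"
        by simp
    qed (use AllI csts_Sent[of "All x A" S'] in auto)
  next
    case (AllE H x A c)
    show ?case
      by (rule step[where ps = "[(H, All x A)]" and L = "{c}"])
        (use AllE in \<open>auto simp: good_def intro!: nd.AllE mem\<close>)
  next
    case (ExI H A c x)
    show ?case
    proof (rule step[where ps = "[(H, A\<langle>Const c/x\<rangle>)]" and L = "insert c (csts A)"])
      fix f K
      assume K: "ok f K" "insert c (csts A) \<subseteq> K" and
        "\<forall>p \<in> set [(H, A\<langle>Const c/x\<rangle>)]. good f K p"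
      then show "nd S (rename f ` H) (rename f (Ex x A))"
        using Sent[OF K(1) ExI.hyps(3)] mem[OF K(1)] by (auto simp: good_def intro: nd.ExI)
    qed (use ExI csts_Sent[of "Ex x A" S'] in auto)
  next
    case (ExE H x A H1 C c)
    show ?case
    \<comment> \<open>The discharged instance need not occur among the hypotheses, so its constants
      are put into \<open>L\<close> explicitly; \<open>NegAllE\<close> below is treated
      alike.\<close>
    proof (rule step[where ps = "[(H, Ex x A), (H1, C)]" and L = "insert c (csts (A\<langle>Const c/x\<rangle>))"])
      fix f K
      assume K: "ok f K" "insert c (csts (A\<langle>Const c/x\<rangle>)) \<subseteq> K" and
        "\<forall>p \<in> set [(H, Ex x A), (H1, C)]. good f K p"
      note * = this(3)[unfolded good_def, simplified]
      have eq: "rename f ` (H1 - {A\<langle>Const c/x\<rangle>}) = rename f ` H1 - {(rename f A)\<langle>Const (f c)/x\<rangle>}"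
        using * K(2) by (subst diff[OF K(1)]) auto
      show "nd S (rename f ` (H \<union> (H1 - {A\<langle>Const c/x\<rangle>}))) (rename f C)"
        unfolding image_Un eq
      proof (rule nd.ExE)
        show "\<forall>D \<in> rename f ` H1 - {(rename f A)\<langle>Const (f c)/x\<rangle>}. f c \<notin> csts D"
          unfolding eq[symmetric] using ExE.hyps(5) * K by (simp add: fresh[OF K(1)] UN_subset_iff)
      qed (use * K ExE in \<open>simp_all add: mem fresh[OF K(1)] UN_subset_iff\<close>)
    next
      show "insert c (csts (A\<langle>Const c/x\<rangle>)) \<subseteq> constants S'"
        using csts_Sent[of "Ex x A" S'] nd_Sent[OF sig ExE.hyps(1)] ExE.hyps(3) csts_subst[of A c x] by auto
    qed (use ExE in auto)
  next
    case (NegAllI H A c x)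
    show ?case
    proof (rule step[where ps = "[(H, \<^bold>\<not> A\<langle>Const c/x\<rangle>)]" and L = "insert c (csts A)"])
      fix f K
      assume K: "ok f K" "insert c (csts A) \<subseteq> K" and
        "\<forall>p \<in> set [(H, \<^bold>\<not> A\<langle>Const c/x\<rangle>)]. good f K p"
      then show "nd S (rename f ` H) (rename f (\<^bold>\<not> (All x A)))"
        using Sent[OF K(1) NegAllI.hyps(3)] mem[OF K(1)] by (auto simp: good_def intro: nd.NegAllI)
    qed (use NegAllI csts_Sent[of "All x A" S'] in auto)
  next
    case (NegAllE H x A H1 C c)
    show ?case
    proof (rule step[where ps = "[(H, \<^bold>\<not> (All x A)), (H1, C)]" and L = "insert c (csts (A\<langle>Const c/x\<rangle>))"])
      fix f K
      assume K: "ok f K" "insert c (csts (A\<langle>Const c/x\<rangle>)) \<subseteq> K" and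
        "\<forall>p \<in> set [(H, \<^bold>\<not> (All x A)), (H1, C)]. good f K p"
      note * = this(3)[unfolded good_def, simplified]
      have eq: "rename f ` (H1 - {\<^bold>\<not> A\<langle>Const c/x\<rangle>}) = rename f ` H1 - {\<^bold>\<not> (rename f A)\<langle>Const (f c)/x\<rangle>}"
        using * K(2) by (subst diff[OF K(1)]) auto
      show "nd S (rename f ` (H \<union> (H1 - {\<^bold>\<not> A\<langle>Const c/x\<rangle>}))) (rename f C)"
        unfolding image_Un eq
      proof (rule nd.NegAllE)
        show "\<forall>D \<in> rename f ` H1 - {\<^bold>\<not> (rename f A)\<langle>Const (f c)/x\<rangle>}. f c \<notin> csts D"
          unfolding eq[symmetric] using NegAllE.hyps(5) * K by (simp add: fresh[OF K(1)] UN_subset_iff)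
      qed (use * K NegAllE in \<open>simp_all add: mem fresh[OF K(1)] UN_subset_iff\<close>)
    next
      show "insert c (csts (A\<langle>Const c/x\<rangle>)) \<subseteq> constants S'"
        using csts_Sent[of "All x A" S'] nd_Sent[OF sig NegAllE.hyps(1)] NegAllE.hyps(3) csts_subst[of A c x]
        by auto
    qed (use NegAllE in auto)
  next
    case (NegExI H A c x)
    show ?case
    proof (rule step[where ps = "[(H, \<^bold>\<not> A\<langle>Const c/x\<rangle>)]" and L = "insert c (csts A)"])
      fix f K
      assume K: "ok f K" "insert c (csts A) \<subseteq> K" and
        "\<forall>p \<in> set [(H, \<^bold>\<not> A\<langle>Const c/x\<rangle>)]. good f K p"
      note * = this(3)[unfolded good_def, simplified]
      have "nd S (rename f ` H) (\<^bold>\<not> (Ex x (rename f A)))"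
      proof (rule nd.NegExI[where c = "f c"])
        show "Ex x (rename f A) \<in> Sent S"
          using Sent[OF K(1) NegExI.hyps(2)] K(2) by simp
      qed (use * K NegExI in \<open>simp_all add: mem fresh[OF K(1)] UN_subset_iff\<close>)
      then show "nd S (rename f ` H) (rename f (\<^bold>\<not> (Ex x A)))"
        by simp
    qed (use NegExI csts_Sent[of "Ex x A" S'] in auto)
  next
    case (NegExE H x A c)
    show ?case
      by (rule step[where ps = "[(H, \<^bold>\<not> (Ex x A))]" and L = "{c}"])
        (use NegExE in \<open>auto simp: good_def intro!: nd.NegExE mem\<close>)
  next
    case (IdI c)
    show ?case
      by (rule step[where ps = "[]" and L = "{c}"])
        (use IdI nd.IdI[of _ S] S mem in auto)
  next
    case (IdE H1 c1 c2 H2 A x)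
    show ?case
    proof (rule step[where ps = "[(H1, Atom (ident S') [Const c1, Const c2]), (H2, A\<langle>Const c1/x\<rangle>)]"
          and L = "csts A"])
      fix f K
      assume K: "ok f K" "csts A \<subseteq> K" and
        "\<forall>p \<in> set [(H1, Atom (ident S') [Const c1, Const c2]), (H2, A\<langle>Const c1/x\<rangle>)]. good f K p"
      note * = this(3)[unfolded good_def, simplified]
      have "rename f A \<in> Form S"
        using IdE.hyps(3) K S wf_form_rename[of S' A S f] by (auto simp: Form_def ok_def)
      then show "nd S (rename f ` (H1 \<union> H2)) (rename f (A\<langle>Const c2/x\<rangle>))"
        unfolding image_Un using * S IdE.hyps(4) nd.IdE[of S _ "f c1" "f c2" _ "rename f A" x] by simp
    next
      show "csts A \<subseteq> constants S'"
        using IdE.hyps(3) by (simp add: Form_def csts_wf_form)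
    qed (use IdE in auto)
  next
    case (AV H A A')
    show ?case
    proof (rule step[where ps = "[(H, A)]" and L = "csts A'"])
      fix f K
      assume K: "ok f K" "csts A' \<subseteq> K" and
        "\<forall>p \<in> set [(H, A)]. good f K p"
      then show "nd S (rename f ` H) (rename f A')"
        using AV.hyps(2) Sent[OF K(1) AV.hyps(3)] alphabetic_variant_rename[of A A' f]
        by (auto simp: good_def intro: nd.AV)
    qed (use AV csts_Sent in auto)
  qed
  then show ?thesis
    by (auto simp: Q_def ok_def)
qed

section \<open>Replacing a constant by a variable\<close>

text \<open>Bound variables are counted too: a variable outside this set can take the place of a
  constant without being captured.\<close>

primrec vars :: "('c, 'p) form \<Rightarrow> nat set" where
  "vars (Atom P ts) = (\<Union>t \<in> set ts. fv_trm t)"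
| "vars (\<^bold>\<not> A) = vars A"
| "vars (\<^bold>\<circ> A) = vars A"
| "vars (\<^bold>\<bullet> A) = vars A"
| "vars (A \<^bold>\<and> B) = vars A \<union> vars B"
| "vars (A \<^bold>\<or> B) = vars A \<union> vars B"
| "vars (All x A) = insert x (vars A)"
| "vars (Ex x A) = insert x (vars A)"

primrec abstract_trm :: "'c \<Rightarrow> nat \<Rightarrow> 'c trm \<Rightarrow> 'c trm" where
  "abstract_trm c x (Var y) = Var y"
| "abstract_trm c x (Const d) = (if d = c then Var x else Const d)"

primrec abstract :: "'c \<Rightarrow> nat \<Rightarrow> ('c, 'p) form \<Rightarrow> ('c, 'p) form" where
  "abstract c x (Atom P ts) = Atom P (map (abstract_trm c x) ts)"
| "abstract c x (\<^bold>\<not> A) = \<^bold>\<not> (abstract c x A)"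
| "abstract c x (\<^bold>\<circ> A) = \<^bold>\<circ> (abstract c x A)"
| "abstract c x (\<^bold>\<bullet> A) = \<^bold>\<bullet> (abstract c x A)"
| "abstract c x (A \<^bold>\<and> B) = abstract c x A \<^bold>\<and> abstract c x B"
| "abstract c x (A \<^bold>\<or> B) = abstract c x A \<^bold>\<or> abstract c x B"
| "abstract c x (All y A) = All y (abstract c x A)"
| "abstract c x (Ex y A) = Ex y (abstract c x A)"

lemma finite_vars: "finite (vars A)"
proof -
  have "finite (fv_trm t)" for t :: "'a trm"
    by (cases t) auto
  then show ?thesis
    by (induction A) simp_all
qed

lemma fv_abstract: "fv (abstract c x A) \<subseteq> insert x (fv A)"
proof -
  have "fv_trm (abstract_trm c x t) \<subseteq> insert x (fv_trm t)" for t
    by (cases t) auto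
  then show ?thesis
    by (induction A) (simp_all, blast+)
qed

text \<open>Keeps the quantifiers of an abstraction from becoming void, as \<open>wf_form\<close>
  demands.\<close>

lemma fv_subset_abstract: "x \<notin> vars A \<Longrightarrow> fv A \<subseteq> fv (abstract c x A)"
proof -
  have "fv_trm t \<subseteq> fv_trm (abstract_trm c x t)" for t
    by (cases t) auto
  then show "x \<notin> vars A \<Longrightarrow> fv A \<subseteq> fv (abstract c x A)"
    by (induction A) (simp_all, blast+)
qed

lemma wf_form_abstract: "x \<notin> vars A \<Longrightarrow> wf_form S A \<Longrightarrow> wf_form S (abstract c x A)"
proof -
  have *: "set_trm (abstract_trm c x t) \<subseteq> set_trm t" for t
    by (cases t) auto
  show "x \<notin> vars A \<Longrightarrow> wf_form S A \<Longrightarrow> wf_form S (abstract c x A)"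
  proof (induction A)
    case (Atom P ts)
    then show ?case
      using subset_trans[OF *] by simp
  qed (auto intro!: fv_subset_abstract[THEN subsetD])
qed

text \<open>Rule \<open>IdE\<close> speaks of instances of one pattern. Through this equation it can
  replace all occurrences of a constant in a sentence at once.\<close>

lemma abstract_subst: "x \<notin> vars A \<Longrightarrow> (abstract c x A)\<langle>Const d/x\<rangle> = rename (id(c := d)) A"
proof -
  have "x \<notin> fv_trm t \<Longrightarrow>
    subst_trm x (Const d) (abstract_trm c x t) = map_trm (id(c := d)) t" for t
    by (cases t) auto
  then show "x \<notin> vars A \<Longrightarrow> (abstract c x A)\<langle>Const d/x\<rangle> = rename (id(c := d)) A"
    by (induction A) auto
qed

lemma rename_id: "rename id A = A"
  by (rule form.map_id)

section \<open>The canonical model\<close>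

text \<open>\<open>All_witness\<close> is the contrapositive of having a counterexample constant for
  every missing universal sentence. Negation is not classical, so this is demanded separately from
  \<open>Ex_witness\<close>.\<close>

locale henkin_theory =
  fixes S :: "('k, 'p) signature" and \<Delta> :: "('k, 'p) form set"
  assumes sig: "is_signature S"
    and Sent: "\<Delta> \<subseteq> Sent S"
    and closed: "nd S H A \<Longrightarrow> H \<subseteq> \<Delta> \<Longrightarrow> A \<in> \<Delta>"
    and prime: "A \<^bold>\<or> B \<in> \<Delta> \<Longrightarrow> A \<in> \<Delta> \<or> B \<in> \<Delta>"
    and proper: "\<exists>A \<in> Sent S. A \<notin> \<Delta>"
    and Ex_witness: "Ex x A \<in> \<Delta> \<Longrightarrow> \<exists>c \<in> constants S. A\<langle>Const c/x\<rangle> \<in> \<Delta>"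
    and All_witness: "All x A \<in> Sent S \<Longrightarrow> \<forall>c \<in> constants S. A\<langle>Const c/x\<rangle> \<in> \<Delta> \<Longrightarrow> All x A \<in> \<Delta>"
begin

section \<open>Membership in a Henkin theory obeys the clauses of a valuation\<close>

lemma hyp: "A \<in> \<Delta> \<Longrightarrow> nd S {A} A"
  using Sent by (auto intro: Hyp)

lemma closed1: "A \<in> \<Delta> \<Longrightarrow> (nd S {A} A \<Longrightarrow> nd S {A} B) \<Longrightarrow> B \<in> \<Delta>"
  using closed[of "{A}" B] hyp by blast

lemma conj_iff: "A \<^bold>\<and> B \<in> \<Delta> \<longleftrightarrow> A \<in> \<Delta> \<and> B \<in> \<Delta>"
proof
  show "A \<in> \<Delta> \<and> B \<in> \<Delta>" if "A \<^bold>\<and> B \<in> \<Delta>"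
    using closed1[OF that] by (blast intro: ConjE1 ConjE2)
  show "A \<^bold>\<and> B \<in> \<Delta>" if "A \<in> \<Delta> \<and> B \<in> \<Delta>"
    using closed[OF ConjI[OF hyp hyp]] that by blast
qed

lemma disj_iff: "A \<in> Sent S \<Longrightarrow> B \<in> Sent S \<Longrightarrow> A \<^bold>\<or> B \<in> \<Delta> \<longleftrightarrow> A \<in> \<Delta> \<or> B \<in> \<Delta>"
  by (meson prime closed1 DisjI1 DisjI2)

lemma neg_conj_iff:
  assumes "A \<in> Sent S" "B \<in> Sent S"
  shows "\<^bold>\<not> (A \<^bold>\<and> B) \<in> \<Delta> \<longleftrightarrow> \<^bold>\<not> A \<in> \<Delta> \<or> \<^bold>\<not> B \<in> \<Delta>"
proof
  assume "\<^bold>\<not> (A \<^bold>\<and> B) \<in> \<Delta>"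
  moreover have "nd S {\<^bold>\<not> A} (\<^bold>\<not> A \<^bold>\<or> \<^bold>\<not> B)" "nd S {\<^bold>\<not> B} (\<^bold>\<not> A \<^bold>\<or> \<^bold>\<not> B)"
    using assms by (simp_all add: DisjI1 DisjI2 Hyp)
  ultimately have "\<^bold>\<not> A \<^bold>\<or> \<^bold>\<not> B \<in> \<Delta>"
    using closed[OF NegConjE[OF hyp]] by blast
  then show "\<^bold>\<not> A \<in> \<Delta> \<or> \<^bold>\<not> B \<in> \<Delta>"
    by (rule prime)
next
  assume "\<^bold>\<not> A \<in> \<Delta> \<or> \<^bold>\<not> B \<in> \<Delta>"
  then show "\<^bold>\<not> (A \<^bold>\<and> B) \<in> \<Delta>"
    using assms by (meson closed1 NegConjI1 NegConjI2)
qed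

lemma neg_disj_iff: "\<^bold>\<not> (A \<^bold>\<or> B) \<in> \<Delta> \<longleftrightarrow> \<^bold>\<not> A \<in> \<Delta> \<and> \<^bold>\<not> B \<in> \<Delta>"
proof
  show "\<^bold>\<not> A \<in> \<Delta> \<and> \<^bold>\<not> B \<in> \<Delta>" if "\<^bold>\<not> (A \<^bold>\<or> B) \<in> \<Delta>"
    using closed1[OF that] by (blast intro: NegDisjE1 NegDisjE2)
  show "\<^bold>\<not> (A \<^bold>\<or> B) \<in> \<Delta>" if "\<^bold>\<not> A \<in> \<Delta> \<and> \<^bold>\<not> B \<in> \<Delta>"
    using closed[OF NegDisjI[OF hyp hyp]] that by blast
qed

lemma neg_neg_iff: "\<^bold>\<not> (\<^bold>\<not> A) \<in> \<Delta> \<longleftrightarrow> A \<in> \<Delta>"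
  by (meson closed1 DNI DNE)

lemma circ_iff:
  assumes "\<^bold>\<circ> A \<in> \<Delta>"
  shows "A \<in> \<Delta> \<longleftrightarrow> \<^bold>\<not> A \<notin> \<Delta>"
proof -
  have "A \<^bold>\<or> \<^bold>\<not> A \<in> \<Delta>"
    by (rule closed1[OF assms]) (rule PEM)
  \<comment> \<open>Otherwise \<open>EXP\<close> would put every sentence into the theory, against
    \<open>proper\<close>.\<close>
  moreover have "\<not> (A \<in> \<Delta> \<and> \<^bold>\<not> A \<in> \<Delta>)"
    using closed[OF EXP[OF hyp hyp hyp]] assms proper by blast
  ultimately show ?thesis
    using prime by blast
qed

lemma circ_bul_iff:
  assumes "A \<in> Sent S"
  shows "\<^bold>\<circ> A \<in> \<Delta> \<longleftrightarrow> \<^bold>\<bullet> A \<notin> \<Delta>"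
proof -
  have "\<^bold>\<circ> A \<^bold>\<or> \<^bold>\<bullet> A \<in> \<Delta>"
    using closed[OF Comp[OF assms]] by blast
  moreover have "\<not> (\<^bold>\<circ> A \<in> \<Delta> \<and> \<^bold>\<bullet> A \<in> \<Delta>)"
    using closed[OF nd.Cons[OF hyp hyp]] proper by blast
  ultimately show ?thesis
    using prime by blast
qed

lemma All_iff:
  "All x A \<in> Sent S \<Longrightarrow> All x A \<in> \<Delta> \<longleftrightarrow> (\<forall>c \<in> constants S. A\<langle>Const c/x\<rangle> \<in> \<Delta>)"
  by (meson All_witness closed1 AllE)

lemma Ex_iff:
  "Ex x A \<in> Sent S \<Longrightarrow> Ex x A \<in> \<Delta> \<longleftrightarrow> (\<exists>c \<in> constants S. A\<langle>Const c/x\<rangle> \<in> \<Delta>)"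
  by (meson Ex_witness closed1 ExI)

lemma ex_fresh: "\<exists>c \<in> constants S. c \<notin> csts A"
  using sig finite_csts[of A] by (metis finite_subset is_signature_def subsetI)

lemma neg_All_iff:
  assumes "All x A \<in> Sent S"
  shows "\<^bold>\<not> (All x A) \<in> \<Delta> \<longleftrightarrow> (\<exists>c \<in> constants S. \<^bold>\<not> A\<langle>Const c/x\<rangle> \<in> \<Delta>)"
proof
  assume neg: "\<^bold>\<not> (All x A) \<in> \<Delta>"
  \<comment> \<open>An eigenconstant for \<open>NegAllE\<close>: the conclusion
    \<open>Ex x (Neg A)\<close> avoids it, and the only hypothesis of the minor derivation is the
    discharged instance.\<close>
  obtain c where c: "c \<in> constants S" "c \<notin> csts A"
    using ex_fresh by blast
  have "Ex x (\<^bold>\<not> A) \<in> Sent S"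
    using assms by (simp add: Sent_def Form_def)
  moreover from this have "nd S {\<^bold>\<not> A\<langle>Const c/x\<rangle>} (\<^bold>\<not> A\<langle>Const c/x\<rangle>)"
    using c Sent_instance[of x "\<^bold>\<not> A" S c] by (simp add: Hyp)
  ultimately have "nd S {\<^bold>\<not> A\<langle>Const c/x\<rangle>} (Ex x (\<^bold>\<not> A))"
    using c by (intro ExI[of S _ "\<^bold>\<not> A" c x]) auto
  then have "nd S ({\<^bold>\<not> (All x A)} \<union> ({\<^bold>\<not> A\<langle>Const c/x\<rangle>} - {\<^bold>\<not> A\<langle>Const c/x\<rangle>})) (Ex x (\<^bold>\<not> A))"
    using c by (intro NegAllE[OF hyp[OF neg]]) auto
  then have "Ex x (\<^bold>\<not> A) \<in> \<Delta>"
    using closed neg by simp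
  then show "\<exists>c \<in> constants S. \<^bold>\<not> A\<langle>Const c/x\<rangle> \<in> \<Delta>"
    using Ex_witness by fastforce
next
  assume "\<exists>c \<in> constants S. \<^bold>\<not> A\<langle>Const c/x\<rangle> \<in> \<Delta>"
  then show "\<^bold>\<not> (All x A) \<in> \<Delta>"
    using assms by (meson closed1 NegAllI)
qed

lemma neg_Ex_iff:
  assumes "Ex x A \<in> Sent S"
  shows "\<^bold>\<not> (Ex x A) \<in> \<Delta> \<longleftrightarrow> (\<forall>c \<in> constants S. \<^bold>\<not> A\<langle>Const c/x\<rangle> \<in> \<Delta>)"
proof
  assume "\<forall>c \<in> constants S. \<^bold>\<not> A\<langle>Const c/x\<rangle> \<in> \<Delta>"
  then have all: "All x (\<^bold>\<not> A) \<in> \<Delta>"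
    using assms by (intro All_witness) (auto simp: Sent_def Form_def)
  \<comment> \<open>\<open>NegExI\<close> needs a single instance at a constant fresh for
    \<open>A\<close>. Deriving it from \<open>All x (Neg A)\<close> keeps that constant out of the
    hypothesis.\<close>
  obtain c where c: "c \<in> constants S" "c \<notin> csts A"
    using ex_fresh by blast
  have "nd S {All x (\<^bold>\<not> A)} (\<^bold>\<not> A\<langle>Const c/x\<rangle>)"
    using AllE[OF hyp[OF all] c(1)] by simp
  then have "nd S {All x (\<^bold>\<not> A)} (\<^bold>\<not> (Ex x A))"
    using assms c by (intro NegExI) auto
  then show "\<^bold>\<not> (Ex x A) \<in> \<Delta>"
    using closed all by blast
next
  assume "\<^bold>\<not> (Ex x A) \<in> \<Delta>"
  then show "\<forall>c \<in> constants S. \<^bold>\<not> A\<langle>Const c/x\<rangle> \<in> \<Delta>"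
    by (meson closed1 NegExE)
qed

lemma variant_iff:
  "A \<in> Sent S \<Longrightarrow> A' \<in> Sent S \<Longrightarrow> alphabetic_variant A A' \<Longrightarrow> A' \<in> \<Delta> \<longleftrightarrow> A \<in> \<Delta>"
  using closed1[of A A'] closed1[of A' A] AV[of S _ A A'] AV[of S _ A' A] alphabetic_variant_sym
  by blast

section \<open>Provable identity and representatives of its classes\<close>

definition eqv :: "'k \<Rightarrow> 'k \<Rightarrow> bool" where
  "eqv c d \<longleftrightarrow> Atom (ident S) [Const c, Const d] \<in> \<Delta>"

lemma eqv_constants: "eqv c d \<Longrightarrow> c \<in> constants S \<and> d \<in> constants S"
  using Sent sig ident_Sent[of S c d] by (auto simp: eqv_def)

lemma eqv_replace:
  assumes "eqv c d" "A\<langle>Const c/x\<rangle> \<in> \<Delta>" "A \<in> Form S" "fv A \<subseteq> {x}"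
  shows "A\<langle>Const d/x\<rangle> \<in> \<Delta>"
  using closed[OF IdE[OF hyp hyp assms(3,4)]] assms(1,2) unfolding eqv_def by blast

lemma eqv_refl: "c \<in> constants S \<Longrightarrow> eqv c c"
  unfolding eqv_def using closed[OF IdI] by blast

lemma eqv_sym:
  assumes "eqv c d"
  shows "eqv d c"
proof -
  \<comment> \<open>With the hole on the left, replacing \<open>c\<close> by \<open>d\<close> turns
    the reflexive atom on \<open>c\<close> into the reversed one.\<close>
  have "(Atom (ident S) [Var 0, Const c])\<langle>Const d/0\<rangle> \<in> \<Delta>"
    using eqv_refl[of c] eqv_constants[OF assms] sig
    by (intro eqv_replace[OF assms]) (auto simp: eqv_def Form_def is_signature_def)
  then show ?thesis
    by (simp add: eqv_def)
qed

lemma eqv_trans: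
  assumes "eqv c d" "eqv d e"
  shows "eqv c e"
proof -
  have "(Atom (ident S) [Const c, Var 0])\<langle>Const e/0\<rangle> \<in> \<Delta>"
    using eqv_constants[OF assms(1)] assms(1) sig
    by (intro eqv_replace[OF assms(2)]) (auto simp: eqv_def Form_def is_signature_def)
  then show ?thesis
    by (simp add: eqv_def)
qed

lemma eqv_subst_iff:
  "eqv c d \<Longrightarrow> A \<in> Form S \<Longrightarrow> fv A \<subseteq> {x} \<Longrightarrow> A\<langle>Const c/x\<rangle> \<in> \<Delta> \<longleftrightarrow> A\<langle>Const d/x\<rangle> \<in> \<Delta>"
  by (meson eqv_replace eqv_sym)

lemma eqv_rename_iff:
  assumes "eqv c d" "A \<in> Sent S"
  shows "rename (id(c := d)) A \<in> \<Delta> \<longleftrightarrow> A \<in> \<Delta>"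
proof -
  obtain x where x: "x \<notin> vars A"
    using finite_vars ex_new_if_finite infinite_UNIV_nat by blast
  have "abstract c x A \<in> Form S" "fv (abstract c x A) \<subseteq> {x}"
    using assms(2) wf_form_abstract[OF x] fv_abstract[of c x A] by (auto simp: Sent_def Form_def)
  \<comment> \<open>Hence the instance of the abstraction at \<open>c\<close> is \<open>A\<close>
    itself.\<close>
  moreover have "id(c := c) = id"
    by (simp add: fun_upd_idem)
  ultimately show ?thesis
    using eqv_subst_iff[OF assms(1), of "abstract c x A" x] abstract_subst[OF x, of c] rename_id
    by metis
qed

definition rep :: "'k \<Rightarrow> 'k" where
  "rep c = (SOME d. eqv c d)"

lemma eqv_rep: "c \<in> constants S \<Longrightarrow> eqv c (rep c)"
  unfolding rep_def by (rule someI) (rule eqv_refl)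

lemma rep_constants: "c \<in> constants S \<Longrightarrow> rep c \<in> constants S"
  using eqv_constants[OF eqv_rep] by simp

text \<open>Equivalent constants define the same predicate \<open>eqv c\<close>, and the choice
  operator selects equal values from equal predicates.\<close>

lemma rep_eqI:
  assumes "eqv c d"
  shows "rep c = rep d"
proof -
  have "eqv c e \<longleftrightarrow> eqv d e" for e
    using eqv_trans[OF assms] eqv_trans[OF eqv_sym[OF assms]] by blast
  then show ?thesis
    by (simp add: rep_def)
qed

lemma rep_rep: "c \<in> constants S \<Longrightarrow> rep (rep c) = rep c"
  using rep_eqI[OF eqv_rep] by simp

text \<open>A sentence has finitely many constants, so they can be replaced one after another by
  \<open>eqv_rename_iff\<close>.\<close>

lemma rename_rep_iff:
  assumes "A \<in> Sent S"
  shows "rename rep A \<in> \<Delta> \<longleftrightarrow> A \<in> \<Delta>"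
proof -
  define f where "f K c = (if c \<in> K then rep c else c)" for K c
  have "rename (f K) A \<in> \<Delta> \<longleftrightarrow> A \<in> \<Delta>" if "finite K" "K \<subseteq> constants S" for K
    using that
  proof (induction K)
    case empty
    have "f {} = id"
      by (auto simp: f_def)
    then show ?case
      by (simp only: rename_id)
  next
    case (insert d K)
    have A: "rename (f K) A \<in> Sent S"
      using csts_Sent[OF assms] rep_constants
      by (intro Sent_rename[OF assms]) (auto simp: f_def)
    \<comment> \<open>A constant replaced earlier may have become \<open>d\<close>; then
      \<open>d\<close> is already a representative and \<open>rep_rep\<close> shows that it stays
      put.\<close>
    have "f (insert d K) = id(d := rep d) \<circ> f K"
      using insert.hyps(2) insert.prems rep_rep by (auto simp: f_def fun_eq_iff)
    then have eq: "rename (f (insert d K)) A = rename (id(d := rep d)) (rename (f K) A)"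
      by (simp only: form.map_comp comp_id)
    have "rename (f K) A \<in> \<Delta> \<longleftrightarrow> A \<in> \<Delta>"
      using insert by blast
    then show ?case
      unfolding eq using insert.prems eqv_rename_iff[OF eqv_rep A, of d] by blast
  qed
  from this[OF finite_csts csts_Sent[OF assms]]
  have "rename (f (csts A)) A \<in> \<Delta> \<longleftrightarrow> A \<in> \<Delta>" .
  moreover have "rename (f (csts A)) A = rename rep A"
    by (intro form.map_cong) (auto simp: f_def)
  ultimately show ?thesis
    by (simp only:)
qed

lemma rep_subst_iff:
  assumes "c \<in> constants S" "wf_form S A" "fv A \<subseteq> {x}"
  shows "A\<langle>Const (rep c)/x\<rangle> \<in> \<Delta> \<longleftrightarrow> A\<langle>Const c/x\<rangle> \<in> \<Delta>"
  using eqv_subst_iff[OF eqv_rep] assms by (auto simp: Form_def)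

text \<open>
  Every sentence is evaluated after all its constants have been replaced by representatives. Two
  constants with the same denotation then become literally equal, which makes the congruence clause
  of valuations trivial.
\<close>

lemma canonical_model:
  fixes S\<^sub>0 :: "('c, 'p) signature" and \<iota> :: "'c \<Rightarrow> 'k" and enc :: "'k \<Rightarrow> 'd"
  assumes S\<^sub>0: "predicates S\<^sub>0 = predicates S" "arity S\<^sub>0 = arity S" "ident S\<^sub>0 = ident S"
    and \<iota>: "\<iota> ` constants S\<^sub>0 \<subseteq> constants S" and "inj enc"
  obtains M :: "('c, 'p, 'd) struct" and v
  where "is_struct S\<^sub>0 M" "valuation S\<^sub>0 M v"
    "\<And>A. A \<in> Sent S\<^sub>0 \<Longrightarrow> v (embed A) \<longleftrightarrow> rename \<iota> A \<in> \<Delta>"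
proof -
  \<comment> \<open>The domain lives in \<open>'d\<close> while the theory speaks about constants in
    \<open>'k\<close>; \<open>dec\<close> leads back from codes to constants.\<close>
  define dec where "dec = inv enc"
  have dec [simp]: "dec (enc c) = c" for c
    using \<open>inj enc\<close> by (simp add: dec_def)
  define R where "R = rep ` constants S"
  have R: "R \<subseteq> constants S"
    using rep_constants by (auto simp: R_def)
  \<comment> \<open>One definition for both extensions: \<open>atm\<close> forms either the atom or
    its negation.\<close>
  define ext where "ext atm P = {as. set as \<subseteq> enc ` R \<and> length as = arity S P \<and>
    atm P (map (\<lambda>a. Const (dec a)) as) \<in> \<Delta>}" for atm :: "'p \<Rightarrow> 'k trm list \<Rightarrow> ('k, 'p) form" and P
  define M :: "('c, 'p, 'd) struct" where
    "M = \<lparr>domain = enc ` R, interp = \<lambda>c. enc (rep (\<iota> c)), pos = ext Atom,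
      neg = ext (\<lambda>P ts. \<^bold>\<not> (Atom P ts))\<rparr>"
  define I where "I = interp (diagram_struct M)"
  define v where "v A \<longleftrightarrow> rename (\<lambda>c. dec (I c)) A \<in> \<Delta>" for A
  let ?r = "rename (\<lambda>c. dec (I c)) :: _ \<Rightarrow> ('k, 'p) form"
  let ?S = "diagram_sig S\<^sub>0 M"
  have I: "I c \<in> enc ` R" if "c \<in> constants ?S" for c
    using that \<iota> by (auto simp: I_def diagram_sig_def diagram_struct_def M_def R_def)
  have dec_I: "dec (I c) \<in> constants S" if "c \<in> constants ?S" for c
    using I[OF that] R by auto
  have r_Sent: "?r A \<in> Sent S" if "A \<in> Sent ?S" for A
    using csts_Sent[OF that] dec_I S\<^sub>0 by (intro Sent_rename[OF that]) (auto simp: diagram_sig_def)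
  have I_Inr: "I (Inr a) = a" for a
    by (simp add: I_def diagram_struct_def)
  have quant: "wf_form S A \<and> fv A \<subseteq> {x}" if "All x A \<in> Sent S \<or> Ex x A \<in> Sent S" for x A
    using that by (auto simp: Sent_def Form_def)
  have "is_struct S\<^sub>0 M"
    unfolding is_struct_def
  proof (intro conjI ballI)
    show "domain M \<noteq> {}"
      using sig by (auto simp: M_def R_def is_signature_def)
    show "interp M c \<in> domain M" if "c \<in> constants S\<^sub>0" for c
      using that \<iota> by (auto simp: M_def R_def)
    show "pos M P \<union> neg M P \<subseteq> {as. length as = arity S\<^sub>0 P \<and> set as \<subseteq> domain M}" for P
      by (auto simp: M_def ext_def S\<^sub>0)
    \<comment> \<open>Among representatives provable identity is equality, which is what a structure
      requires of the positive extension of identity.\<close>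
    have "\<forall>c \<in> R. \<forall>d \<in> R. Atom (ident S) [Const c, Const d] \<in> \<Delta> \<longleftrightarrow> c = d"
    proof (intro ballI iffI)
      fix c d
      assume c: "c \<in> R" and d: "d \<in> R"
      show "c = d" if "Atom (ident S) [Const c, Const d] \<in> \<Delta>"
        using c d rep_eqI[of c d] that rep_rep by (auto simp: R_def eqv_def)
      show "Atom (ident S) [Const c, Const d] \<in> \<Delta>" if "c = d"
        using c R eqv_refl[of c] that by (auto simp: eqv_def)
    qed
    moreover have "arity S (ident S) = 2"
      using sig by (simp add: is_signature_def)
    ultimately show "pos M (ident S\<^sub>0) = {[a, a] |a. a \<in> domain M}"
      by (auto simp: M_def ext_def S\<^sub>0 length_Suc_conv numeral_2_eq_2)
  qed
  moreover have "valuation S\<^sub>0 M v"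
  proof
    fix P cs
    assume cs: "P \<in> predicates S\<^sub>0" "length cs = arity S\<^sub>0 P" "set cs \<subseteq> constants ?S"
    have "set (map I cs) \<subseteq> enc ` R"
      using cs(3) I by auto
    then show "v (Atom P (map Const cs)) \<longleftrightarrow> map (interp (diagram_struct M)) cs \<in> pos M P"
      "v (\<^bold>\<not> (Atom P (map Const cs))) \<longleftrightarrow> map (interp (diagram_struct M)) cs \<in> neg M P"
      unfolding I_def[symmetric] using cs(2) S\<^sub>0 by (auto simp: v_def M_def ext_def comp_def)
  next
    fix A B
    assume "A \<in> Sent ?S" "B \<in> Sent ?S"
    note r_Sent[OF this(1)] r_Sent[OF this(2)]
    then show "v (A \<^bold>\<and> B) \<longleftrightarrow> v A \<and> v B" "v (A \<^bold>\<or> B) \<longleftrightarrow> v A \<or> v B"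
      "v (\<^bold>\<not> (A \<^bold>\<and> B)) \<longleftrightarrow> v (\<^bold>\<not> A) \<or> v (\<^bold>\<not> B)" "v (\<^bold>\<not> (A \<^bold>\<or> B)) \<longleftrightarrow> v (\<^bold>\<not> A) \<and> v (\<^bold>\<not> B)"
      by (simp_all add: v_def conj_iff disj_iff neg_conj_iff neg_disj_iff)
  next
    fix A
    assume A: "A \<in> Sent ?S"
    show "v (\<^bold>\<not> (\<^bold>\<not> A)) \<longleftrightarrow> v A" "v (\<^bold>\<circ> A) \<longleftrightarrow> \<not> v (\<^bold>\<bullet> A)"
      using r_Sent[OF A] by (simp_all add: v_def neg_neg_iff circ_bul_iff)
    show "v A \<longleftrightarrow> \<not> v (\<^bold>\<not> A)" if "v (\<^bold>\<circ> A)"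
      using circ_iff[of "?r A"] that by (simp add: v_def)
  next
    fix x A
    assume A: "All x A \<in> Sent ?S"
    have All: "All x (?r A) \<in> Sent S"
      using r_Sent[OF A] by simp
    then have *: "wf_form S (?r A)" "fv (?r A) \<subseteq> {x}"
      using quant by blast+
    \<comment> \<open>The domain runs over representatives, whereas \<open>All_iff\<close> runs over
      all constants; \<open>rep_subst_iff\<close> shows that the instances agree. The other three
      quantifier clauses follow in the same way.\<close>
    show "v (All x A) \<longleftrightarrow> (\<forall>a \<in> domain M. v (A\<langle>Const (Inr a)/x\<rangle>))"
      using All_iff[OF All] rep_subst_iff[OF _ *] by (simp add: v_def M_def R_def I_Inr)
    show "v (\<^bold>\<not> (All x A)) \<longleftrightarrow> (\<exists>a \<in> domain M. v (\<^bold>\<not> A\<langle>Const (Inr a)/x\<rangle>))"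
      using neg_All_iff[OF All] rep_subst_iff[of _ "\<^bold>\<not> (?r A)" x] *
      by (simp add: v_def M_def R_def I_Inr)
  next
    fix x A
    assume A: "Ex x A \<in> Sent ?S"
    have Ex: "Ex x (?r A) \<in> Sent S"
      using r_Sent[OF A] by simp
    then have *: "wf_form S (?r A)" "fv (?r A) \<subseteq> {x}"
      using quant by blast+
    show "v (Ex x A) \<longleftrightarrow> (\<exists>a \<in> domain M. v (A\<langle>Const (Inr a)/x\<rangle>))"
      using Ex_iff[OF Ex] rep_subst_iff[OF _ *] by (simp add: v_def M_def R_def I_Inr)
    show "v (\<^bold>\<not> (Ex x A)) \<longleftrightarrow> (\<forall>a \<in> domain M. v (\<^bold>\<not> A\<langle>Const (Inr a)/x\<rangle>))"
      using neg_Ex_iff[OF Ex] rep_subst_iff[of _ "\<^bold>\<not> (?r A)" x] *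
      by (simp add: v_def M_def R_def I_Inr)
  next
    fix A A'
    assume "A \<in> Sent ?S" "A' \<in> Sent ?S" "alphabetic_variant A A'"
    then show "v A' \<longleftrightarrow> v A"
      unfolding v_def by (intro variant_iff r_Sent alphabetic_variant_rename)
  next
    fix A x c1 c2 and op :: "('c + 'd, 'p) form \<Rightarrow> ('c + 'd, 'p) form"
    assume "interp (diagram_struct M) c1 = interp (diagram_struct M) c2" "op \<in> {Neg, Circ, Bul}"
    then show "v (op (A\<langle>Const c1/x\<rangle>)) \<longleftrightarrow> v (op (A\<langle>Const c2/x\<rangle>))"
      unfolding I_def[symmetric] by (auto simp: v_def)
  qed
  moreover have "v (embed A) \<longleftrightarrow> rename \<iota> A \<in> \<Delta>" if "A \<in> Sent S\<^sub>0" for A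
  proof -
    have "rename \<iota> A \<in> Sent S"
      using \<iota> S\<^sub>0 csts_Sent[OF that] by (intro Sent_rename[OF that]) auto
    \<comment> \<open>An original constant \<open>c\<close> denotes the code of
      \<open>rep (\<iota> c)\<close>, so \<open>v\<close> evaluates the translation of
      \<open>A\<close> with representatives put in.\<close>
    from rename_rep_iff[OF this] show ?thesis
      by (simp add: v_def form.map_comp comp_def I_def diagram_struct_def M_def)
  qed
  ultimately show thesis
    using that by blast
qed

end

section \<open>Witnessing constants\<close>

text \<open>The recursion lets \<open>F\<close> contain witnessing constants itself, so one type
  provides witnesses for the extended language too, with no tower of successive extensions.\<close>

datatype ('c, 'p) henkin = Base 'c | Wit "(('c, 'p) henkin, 'p) form"

text \<open>Measures how witnesses are nested. This gives the freshness of \<open>Wit F\<close> for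
  \<open>F\<close> and an order in which witnesses can be eliminated.\<close>

lemma size_csts_less:
  assumes "c \<in> csts F"
  shows "size c < size (Wit F)"
proof -
  have "size c < size_form size (\<lambda>_. 0) F"
    using assms
  proof (induction F)
    case (Atom P ts)
    then obtain t where t: "t \<in> set ts" "c \<in> set_trm t"
      by auto
    have "size c < size_trm size t"
      using t(2) by (cases t) auto
    then show ?case
      using size_list_estimation[OF t(1)] by (simp add: less_SucI)
  qed auto
  then show ?thesis
    by simp
qed

lemma Wit_notin_csts: "Wit F \<notin> csts F"
  using size_csts_less by blast

text \<open>
  The sentences \<open>F\<close> index the Henkin implications from \<open>premise F\<close> to \<open>conclusion F\<close>; for a
  sentence \<open>F\<close> that is not quantified the implication is trivial.
\<close>

fun premise :: "(('c, 'p) henkin, 'p) form \<Rightarrow> (('c, 'p) henkin, 'p) form" where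
  "premise (All x A) = A\<langle>Const (Wit (All x A))/x\<rangle>"
| "premise F = F"

fun conclusion :: "(('c, 'p) henkin, 'p) form \<Rightarrow> (('c, 'p) henkin, 'p) form" where
  "conclusion (Ex x A) = A\<langle>Const (Wit (Ex x A))/x\<rangle>"
| "conclusion F = F"

lemma csts_premise_conclusion: "csts (premise F) \<union> csts (conclusion F) \<subseteq> insert (Wit F) (csts F)"
  using csts_subst by (cases F) fastforce+

text \<open>
  The language has no implication, so assuming the Henkin implication of \<open>F\<close> is expressed by a
  case distinction: either its premise fails, which is absorbed into the disjunction on the right,
  or its conclusion holds.
\<close>

primrec derivable ::
  "(('c, 'p) henkin, 'p) signature \<Rightarrow> (('c, 'p) henkin, 'p) form list \<Rightarrow>
    (('c, 'p) henkin, 'p) form set \<Rightarrow> (('c, 'p) henkin, 'p) form \<Rightarrow> bool" where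
  "derivable S [] X A \<longleftrightarrow> provable S X A"
| "derivable S (F # Fs) X A \<longleftrightarrow>
    derivable S Fs X (A \<^bold>\<or> premise F) \<and> derivable S Fs (insert (conclusion F) X) A"

section \<open>Structural rules for derivability from Henkin implications\<close>

locale henkin_signature =
  fixes S :: "(('c, 'p) henkin, 'p) signature"
  assumes sig: "is_signature S" and Wit: "range Wit \<subseteq> constants S"
begin

lemma premise_Sent: "F \<in> Sent S \<Longrightarrow> premise F \<in> Sent S"
  using Wit by (cases F) (auto intro: Sent_instance)

lemma conclusion_Sent: "F \<in> Sent S \<Longrightarrow> conclusion F \<in> Sent S"
  using Wit by (cases F) (auto intro: Sent_instance)

text \<open>Both sides must vary in the induction, since the recursion of \<open>derivable\<close>
  adds a disjunct on the right in one branch and a hypothesis in the other.\<close>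

lemma derivable_mono:
  assumes "derivable S Fs X A" "X \<subseteq> Y" "A \<in> Sent S" "provable S {A} B" "set Fs \<subseteq> Sent S"
  shows "derivable S Fs Y B"
  using assms
proof (induction Fs arbitrary: X Y A B)
  case Nil
  then show ?case
    using provable_mono[of S X A Y] provable_mono[of S "{A}" B "insert A Y"]
    by (auto intro: provable_cut[OF sig])
next
  case (Cons F Fs)
  have B: "B \<in> Sent S" and P: "premise F \<in> Sent S"
    using Cons.prems provable_Sent[OF sig] premise_Sent by auto
  have "provable S {A \<^bold>\<or> premise F} (B \<^bold>\<or> premise F)"
  proof (rule provable_disjE)
    show "provable S {A \<^bold>\<or> premise F} (A \<^bold>\<or> premise F)"
      using Cons.prems(3) P by (intro provable_hyp) auto
    show "provable S {A, A \<^bold>\<or> premise F} (B \<^bold>\<or> premise F)"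
      using provable_mono[OF Cons.prems(4)] P by (intro provable_disjI1) auto
    show "provable S {premise F, A \<^bold>\<or> premise F} (B \<^bold>\<or> premise F)"
      using B P by (intro provable_disjI2 provable_hyp) auto
  qed
  then show ?case
    using Cons.IH[of X "A \<^bold>\<or> premise F" Y "B \<^bold>\<or> premise F"]
      Cons.IH[of "insert (conclusion F) X" A "insert (conclusion F) Y" B] Cons.prems P
    by auto
qed

lemma derivable_cut:
  assumes "derivable S Fs X (A \<^bold>\<or> C)" "derivable S Fs (insert C X) A"
    "A \<in> Sent S" "C \<in> Sent S" "set Fs \<subseteq> Sent S"
  shows "derivable S Fs X A"
  using assms
proof (induction Fs arbitrary: X A)
  case Nil
  then show ?case
    by (auto intro: provable_disjE[of S X A C] provable_hyp)
next
  case (Cons F Fs)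
  have P: "premise F \<in> Sent S"
    using Cons.prems premise_Sent by auto
  \<comment> \<open>The recursion leaves the cut formula between the other disjuncts;
    \<open>?E\<close> moves it to the end, where the induction hypothesis expects it.\<close>
  let ?D = "(A \<^bold>\<or> C) \<^bold>\<or> premise F" and ?E = "(A \<^bold>\<or> premise F) \<^bold>\<or> C"
  have "provable S {?D} ?E"
  proof (rule provable_disjE)
    show "provable S {?D} ?D"
      using Cons.prems P by (intro provable_hyp) auto
    show "provable S {A \<^bold>\<or> C, ?D} ?E"
    proof (rule provable_disjE)
      show "provable S {A \<^bold>\<or> C, ?D} (A \<^bold>\<or> C)"
        using Cons.prems by (intro provable_hyp) auto
      show "provable S {A, A \<^bold>\<or> C, ?D} ?E"
        using Cons.prems P by (intro provable_disjI1 provable_hyp) auto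
      show "provable S {C, A \<^bold>\<or> C, ?D} ?E"
        using Cons.prems P by (intro provable_disjI2 provable_hyp) auto
    qed
    show "provable S {premise F, ?D} ?E"
      using Cons.prems P by (intro provable_disjI1[OF provable_disjI2] provable_hyp) auto
  qed
  then have "derivable S Fs X ?E"
    using Cons.prems P by (intro derivable_mono[of Fs X ?D X ?E]) auto
  then show ?case
    using Cons.IH[of X "A \<^bold>\<or> premise F"] Cons.IH[of "insert (conclusion F) X" A] Cons.prems P
    by (auto simp: insert_commute)
qed

lemma derivable_Cons:
  assumes "derivable S Fs X A" "A \<in> Sent S" "set (F # Fs) \<subseteq> Sent S"
  shows "derivable S (F # Fs) X A"
proof -
  have "provable S {A} A"
    using assms(2) by (simp add: provable_hyp)
  moreover from this have "provable S {A} (A \<^bold>\<or> premise F)"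
    using assms(3) by (simp add: provable_disjI1 premise_Sent)
  ultimately have "derivable S Fs X (A \<^bold>\<or> premise F)" "derivable S Fs (insert (conclusion F) X) A"
    using assms by (auto intro: derivable_mono[OF assms(1)])
  then show ?thesis
    by simp
qed

lemma derivable_of_provable:
  assumes "provable S X A" "set Fs \<subseteq> Sent S"
  shows "derivable S Fs X A"
  using assms(2)
proof (induction Fs)
  case (Cons F Fs)
  then show ?case
    using provable_Sent[OF sig assms(1)] by (intro derivable_Cons) auto
qed (simp add: assms(1))

text \<open>The implication of \<open>F\<close> acts as a rule: in one branch the premise is wanted
  as a disjunct and is a hypothesis, in the other the conclusion is itself a hypothesis.\<close>

lemma derivable_witness:
  assumes "F \<in> set Fs" "set Fs \<subseteq> Sent S"
  shows "derivable S Fs (insert (premise F) X) (conclusion F)"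
  using assms
proof (induction Fs)
  case (Cons G Fs)
  show ?case
  proof (cases "F = G")
    case True
    have "premise F \<in> Sent S" "conclusion F \<in> Sent S"
      using Cons.prems premise_Sent conclusion_Sent by auto
    then have "provable S (insert (premise F) X) (conclusion F \<^bold>\<or> premise F)"
      "provable S (insert (conclusion F) (insert (premise F) X)) (conclusion F)"
      by (auto intro: provable_disjI2 provable_hyp)
    then show ?thesis
      using True Cons.prems by (auto intro: derivable_of_provable)
  next
    case False
    then show ?thesis
      using Cons conclusion_Sent by (intro derivable_Cons) auto
  qed
qed simp

text \<open>Order and repetition of implications are immaterial. An implication of \<open>Fs\<close>
  is simulated over \<open>Gs\<close> by two cuts, on its premise and on the conclusion that
  \<open>derivable_witness\<close> supplies from it.\<close>

lemma derivable_weaken: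
  assumes "derivable S Fs X A" "set Fs \<subseteq> set Gs" "set Gs \<subseteq> Sent S" "A \<in> Sent S"
  shows "derivable S Gs X A"
  using assms
proof (induction Fs arbitrary: X A)
  case Nil
  then show ?case
    by (simp add: derivable_of_provable)
next
  case (Cons F Fs)
  have Sent: "premise F \<in> Sent S" "conclusion F \<in> Sent S"
    using Cons.prems premise_Sent conclusion_Sent by auto
  have 1: "derivable S Gs X (A \<^bold>\<or> premise F)" and 2: "derivable S Gs (insert (conclusion F) X) A"
    using Cons.IH[of X "A \<^bold>\<or> premise F"] Cons.IH[of "insert (conclusion F) X" A]
      Cons.prems Sent by simp_all
  have "derivable S Gs (insert (premise F) X) (A \<^bold>\<or> conclusion F)"
    using Cons.prems Sent
    by (intro derivable_mono[OF derivable_witness[of F Gs X]] provable_disjI2 provable_hyp) auto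
  moreover have "derivable S Gs (insert (conclusion F) (insert (premise F) X)) A"
    using Cons.prems by (intro derivable_mono[OF 2] provable_hyp) auto
  ultimately have "derivable S Gs (insert (premise F) X) A"
    using Cons.prems Sent by (intro derivable_cut[of Gs "insert (premise F) X" A "conclusion F"]) auto
  then show ?case
    using Cons.prems Sent 1 by (intro derivable_cut[of Gs X A "premise F"]) auto
qed

lemma derivable_compact:
  assumes "derivable S Fs X A" "A \<in> Sent S" "set Fs \<subseteq> Sent S"
  shows "\<exists>Y. finite Y \<and> Y \<subseteq> X \<and> derivable S Fs Y A"
  using assms
proof (induction Fs arbitrary: X A)
  case Nil
  then obtain H where "H \<subseteq> X" "nd S H A"
    by (auto simp: provable_def)
  then show ?case
    using nd_Sent[OF sig] by (intro exI[of _ H]) (auto simp: provable_def)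
next
  case (Cons F Fs)
  have P: "premise F \<in> Sent S"
    using Cons.prems premise_Sent by auto
  obtain Y1 where Y1: "finite Y1" "Y1 \<subseteq> X" "derivable S Fs Y1 (A \<^bold>\<or> premise F)"
    using Cons.IH[of X "A \<^bold>\<or> premise F"] Cons.prems P by auto
  obtain Y2 where Y2: "finite Y2" "Y2 \<subseteq> insert (conclusion F) X" "derivable S Fs Y2 A"
    using Cons.IH[of "insert (conclusion F) X" A] Cons.prems by auto
  let ?Y = "Y1 \<union> (Y2 - {conclusion F})"
  have "derivable S Fs ?Y (A \<^bold>\<or> premise F)"
    using Cons.prems P by (intro derivable_mono[OF Y1(3)] provable_hyp) auto
  moreover have "derivable S Fs (insert (conclusion F) ?Y) A"
    using Cons.prems by (intro derivable_mono[OF Y2(3)] provable_hyp) auto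
  moreover have "finite ?Y" "?Y \<subseteq> X"
    using Y1 Y2 by auto
  ultimately show ?case
    by (intro exI[of _ ?Y]) simp
qed

text \<open>\<open>AllI\<close> turns the disjunction with the counterexample instance into one with
  \<open>F\<close>; \<open>ExE\<close> replaces the witness instance among the hypotheses by
  \<open>F\<close>. In the remaining cases premise or conclusion is already \<open>F\<close>, and a
  case distinction on \<open>A\<close> or \<open>F\<close> finishes.\<close>

lemma provable_eliminate_witness:
  assumes "provable S X (A \<^bold>\<or> premise F)" "provable S (insert (conclusion F) X) A"
    and F: "F \<in> Sent S" and fresh: "\<forall>B \<in> insert A X. Wit F \<notin> csts B"
  shows "provable S X A"
proof -
  have Wit_F: "Wit F \<in> constants S"
    using Wit by blast
  have "provable S X (A \<^bold>\<or> F)"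
  proof (cases "\<exists>x B. F = All x B")
    case True
    then obtain x B where FB: "F = All x B"
      by blast
    obtain H where H: "nd S H (A \<^bold>\<or> premise F)" "H \<subseteq> X"
      using assms(1) by (auto simp: provable_def)
    have "nd S H (A \<^bold>\<or> All x B)"
    proof (rule AllI)
      show "nd S H (A \<^bold>\<or> B\<langle>Const (Wit F)/x\<rangle>)"
        using H by (simp add: FB)
      show "Wit F \<notin> csts B \<union> csts A"
        using Wit_notin_csts[of F] fresh by (simp add: FB)
    qed (use F FB Wit_F H fresh in auto)
    with H(2) show ?thesis
      unfolding provable_def FB by blast
  next
    case False
    then have "premise F = F"
      by (cases F) auto
    then show ?thesis
      using assms(1) by simp
  qed
  moreover have "provable S (insert F X) A"
  proof (cases "\<exists>x B. F = Ex x B")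
    case True
    then obtain x B where FB: "F = Ex x B"
      by blast
    obtain H where H: "nd S H A" "H \<subseteq> insert (conclusion F) X"
      using assms(2) by (auto simp: provable_def)
    have "nd S ({F} \<union> (H - {B\<langle>Const (Wit F)/x\<rangle>})) A"
    proof (rule ExE)
      show "nd S {F} (Ex x B)"
        using F by (simp add: Hyp flip: FB)
      show "Wit F \<notin> csts B \<union> csts A"
        using Wit_notin_csts[of F] fresh by (simp add: FB)
      show "\<forall>D \<in> H - {B\<langle>Const (Wit F)/x\<rangle>}. Wit F \<notin> csts D"
        using H fresh by (auto simp: FB)
    qed (use H Wit_F in auto)
    moreover have "{F} \<union> (H - {B\<langle>Const (Wit F)/x\<rangle>}) \<subseteq> insert F X"
      using H(2) by (auto simp: FB)
    ultimately show ?thesis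
      unfolding provable_def by blast
  next
    case False
    then have "conclusion F = F"
      by (cases F) auto
    then show ?thesis
      using assms(2) by simp
  qed
  moreover have "provable S (insert A X) A"
    using provable_Sent[OF sig assms(2)] by (simp add: provable_hyp)
  ultimately show ?thesis
    using provable_disjE[of S X A F A] by blast
qed

text \<open>The last implication is unfolded innermost and can be removed there. Unfolding an
  earlier \<open>G\<close> adds only constants of \<open>G\<close> and \<open>Wit G\<close>, so
  \<open>Wit F\<close> remains fresh.\<close>

lemma derivable_eliminate_witness:
  assumes "derivable S (Fs @ [F]) X A" "F \<in> Sent S" "\<forall>B \<in> insert A X. Wit F \<notin> csts B"
    "F \<notin> set Fs" "\<forall>G \<in> set Fs. Wit F \<notin> csts G"
  shows "derivable S Fs X A"
  using assms
proof (induction Fs arbitrary: X A)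
  case Nil
  then show ?case
    using provable_eliminate_witness[of X A F] by simp
next
  case (Cons G Fs)
  have "Wit F \<notin> csts (premise G)" "Wit F \<notin> csts (conclusion G)"
    using csts_premise_conclusion[of G] Cons.prems by auto
  then show ?case
    using Cons by simp
qed

text \<open>A constant occurring in \<open>F\<close> is smaller than \<open>Wit F\<close>, so eliminate the largest witness first.\<close>

lemma derivable_conservative:
  assumes "derivable S Fs X A" "set Fs \<subseteq> Sent S" "A \<in> Sent S"
    and base: "\<forall>B \<in> insert A X. csts B \<subseteq> range Base"
  shows "provable S X A"
proof -
  have "provable S X A"
    if "derivable S Gs X A" "set Gs \<subseteq> Sent S" "distinct Gs"
      "sorted (map (\<lambda>G. size (Wit G)) Gs)" for Gs
    using that
  proof (induction Gs rule: rev_induct)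
    case (snoc F Gs)
    \<comment> \<open>A sentence containing \<open>Wit F\<close> would have a strictly larger
      witness than \<open>F\<close>, but \<open>F\<close> comes last in the sorted list.\<close>
    have "Wit F \<notin> csts G" if "G \<in> set Gs" for G
      using that snoc.prems(4) size_csts_less[of "Wit F" G] by (fastforce simp: sorted_append)
    moreover have "\<forall>B \<in> insert A X. Wit F \<notin> csts B"
      using base by blast
    ultimately have "derivable S Gs X A"
      using snoc.prems by (intro derivable_eliminate_witness[of Gs F]) auto
    then show ?case
      using snoc by (simp add: sorted_append)
  qed simp
  moreover have "derivable S (sort_key (\<lambda>G. size (Wit G)) (remdups Fs)) X A"
    using assms by (intro derivable_weaken[OF assms(1)]) auto
  ultimately show ?thesis
    using assms(2) by simp
qed

section \<open>Extension to a maximal theory not deriving \<open>A\<close>\<close>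

lemma henkin_extension:
  assumes "X \<subseteq> Sent S" "A \<in> Sent S" "\<forall>B \<in> insert A X. csts B \<subseteq> range Base" "\<not> provable S X A"
  obtains \<Delta> where "henkin_theory S \<Delta>" "X \<subseteq> \<Delta>" "A \<notin> \<Delta>"
proof -
  define D where "D Y B \<longleftrightarrow> (\<exists>Fs. set Fs \<subseteq> Sent S \<and> derivable S Fs Y B)" for Y B
  have D_provable: "D Y B" if "provable S Y B" for Y B
    using that derivable_of_provable[of Y B "[]"] unfolding D_def by (intro exI[of _ "[]"]) simp
  have D_mono: "D Y' C" if "D Y B" "Y \<subseteq> Y'" "B \<in> Sent S" "provable S {B} C" for Y Y' B C
    using that derivable_mono unfolding D_def by blast
  have D_cut: "D Y B" if cut: "D Y C" "D (insert C Y) B" "B \<in> Sent S" "C \<in> Sent S" for Y B C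
  proof -
    have "D Y (B \<^bold>\<or> C)"
      using cut by (intro D_mono[OF cut(1)] provable_disjI2 provable_hyp) auto
    then obtain Fs Gs where Fs: "set Fs \<subseteq> Sent S" "derivable S Fs Y (B \<^bold>\<or> C)"
      and Gs: "set Gs \<subseteq> Sent S" "derivable S Gs (insert C Y) B"
      using cut(2) unfolding D_def by blast
    \<comment> \<open>Two derivations with different implications are brought to the common list
      before they are cut together.\<close>
    have "derivable S (Fs @ Gs) Y (B \<^bold>\<or> C)" "derivable S (Fs @ Gs) (insert C Y) B"
      using derivable_weaken[OF Fs(2), of "Fs @ Gs"] derivable_weaken[OF Gs(2), of "Fs @ Gs"]
        Fs(1) Gs(1) cut(3,4) by simp_all
    then have "derivable S (Fs @ Gs) Y B"
      using Fs(1) Gs(1) cut(3,4) by (intro derivable_cut[of "Fs @ Gs" Y B C]) simp_all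
    then show ?thesis
      using Fs(1) Gs(1) unfolding D_def by (intro exI[of _ "Fs @ Gs"]) simp
  qed
  have D_witness: "D Y (conclusion F)" if "premise F \<in> Y" "F \<in> Sent S" for F Y
    using derivable_witness[of F "[F]" Y] that unfolding D_def
    by (intro exI[of _ "[F]"]) (simp add: insert_absorb)
  define \<A> where "\<A> = {T. X \<subseteq> T \<and> T \<subseteq> Sent S \<and> \<not> D T A}"
  have "\<exists>M \<in> \<A>. \<forall>T \<in> \<A>. M \<subseteq> T \<longrightarrow> T = M"
  proof (rule subset_Zorn_nonempty)
    \<comment> \<open>Neither \<open>X\<close> nor \<open>A\<close> contains a witness, so the
      implications are conservative over them.\<close>
    have "\<not> D X A"
      using derivable_conservative[OF _ _ assms(2,3)] assms(4) unfolding D_def by blast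
    then have "X \<in> \<A>"
      using assms(1) by (simp add: \<A>_def)
    then show "\<A> \<noteq> {}"
      by blast
  next
    fix \<C>
    assume \<C>: "\<C> \<noteq> {}" "subset.chain \<A> \<C>"
    have sub: "X \<subseteq> T" "T \<subseteq> Sent S" "\<not> D T A" if "T \<in> \<C>" for T
      using that \<C>(2) by (auto simp: \<A>_def subset.chain_def)
    have "\<not> D (\<Union>\<C>) A"
    proof
      assume "D (\<Union>\<C>) A"
      then obtain Fs where Fs: "set Fs \<subseteq> Sent S" "derivable S Fs (\<Union>\<C>) A"
        unfolding D_def by blast
      \<comment> \<open>Only finitely many hypotheses are used, and a chain has a member containing
        them all.\<close>
      then obtain Y where Y: "finite Y" "Y \<subseteq> \<Union>\<C>" "derivable S Fs Y A"
        using derivable_compact[of Fs "\<Union>\<C>" A] assms(2) by blast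
      then obtain T where T: "T \<in> \<C>" "Y \<subseteq> T"
        using finite_subset_Union_chain[OF Y(1,2) \<C>] by blast
      have "D Y A"
        using Fs(1) Y(3) unfolding D_def by blast
      then have "D T A"
        using T(2) assms(2) by (rule D_mono) (simp add: assms(2) provable_hyp)
      then show False
        using sub(3)[OF T(1)] by blast
    qed
    then show "\<Union>\<C> \<in> \<A>"
      using \<C>(1) sub(1,2) unfolding \<A>_def by blast
  qed
  then obtain \<Delta> where "\<Delta> \<in> \<A>" and max: "\<forall>T \<in> \<A>. \<Delta> \<subseteq> T \<longrightarrow> T = \<Delta>"
    by blast
  then have \<Delta>: "X \<subseteq> \<Delta>" "\<Delta> \<subseteq> Sent S" "\<not> D \<Delta> A"
    by (simp_all add: \<A>_def)
  have extend: "D (insert B \<Delta>) A" if "B \<in> Sent S" "B \<notin> \<Delta>" for B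
  proof (rule ccontr)
    assume "\<not> D (insert B \<Delta>) A"
    then have "insert B \<Delta> \<in> \<A>"
      using \<Delta> that(1) by (auto simp: \<A>_def)
    then show False
      using max that(2) by blast
  qed
  have D_closed: "B \<in> \<Delta>" if "D \<Delta> B" "B \<in> Sent S" for B
  proof (rule ccontr)
    assume "B \<notin> \<Delta>"
    from D_cut[OF that(1) extend[OF that(2) this] assms(2) that(2)] show False
      using \<Delta>(3) by blast
  qed
  have A_notin: "A \<notin> \<Delta>"
    using \<Delta>(3) D_provable[OF provable_hyp[OF _ assms(2)]] by blast
  have "henkin_theory S \<Delta>"
  proof
    show "B \<in> \<Delta>" if "nd S H B" "H \<subseteq> \<Delta>" for H B
      using that nd_Sent[OF sig] by (intro D_closed D_provable) (auto simp: provable_def)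
    show "B \<in> \<Delta> \<or> C \<in> \<Delta>" if "B \<^bold>\<or> C \<in> \<Delta>" for B C
    proof (rule ccontr)
      assume neither: "\<not> (B \<in> \<Delta> \<or> C \<in> \<Delta>)"
      have BC: "B \<in> Sent S" "C \<in> Sent S"
        using that \<Delta>(2) by auto
      obtain Fs Gs where Fs: "set Fs \<subseteq> Sent S" "derivable S Fs (insert B \<Delta>) A"
        and Gs: "set Gs \<subseteq> Sent S" "derivable S Gs (insert C \<Delta>) A"
        using neither extend[OF BC(1)] extend[OF BC(2)] unfolding D_def by blast
      let ?Fs = "Fs @ Gs"
      have B: "derivable S ?Fs (insert B \<Delta>) A" and C: "derivable S ?Fs (insert C \<Delta>) A"
        using derivable_weaken[OF Fs(2), of ?Fs] derivable_weaken[OF Gs(2), of ?Fs]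
          Fs(1) Gs(1) assms(2) by simp_all
      \<comment> \<open>Over a common list, both \<open>B\<close> and \<open>C\<close> lead to
        \<open>A\<close>. Cutting first \<open>C\<close> and then \<open>B\<close> from this
        disjunction leaves \<open>A\<close>, against maximality.\<close>
      have "provable S \<Delta> ((A \<^bold>\<or> B) \<^bold>\<or> C)"
      proof (rule provable_disjE)
        show "provable S \<Delta> (B \<^bold>\<or> C)"
          using that \<Delta>(2) by (intro provable_hyp) auto
        show "provable S (insert B \<Delta>) ((A \<^bold>\<or> B) \<^bold>\<or> C)"
          using BC assms(2) by (intro provable_disjI1[OF provable_disjI2] provable_hyp) auto
        show "provable S (insert C \<Delta>) ((A \<^bold>\<or> B) \<^bold>\<or> C)"
          using BC assms(2) by (intro provable_disjI2 provable_hyp) auto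
      qed
      then have "derivable S ?Fs \<Delta> ((A \<^bold>\<or> B) \<^bold>\<or> C)"
        using Fs Gs by (intro derivable_of_provable) auto
      moreover have "derivable S ?Fs (insert C \<Delta>) (A \<^bold>\<or> B)"
        using BC Fs Gs assms(2) by (intro derivable_mono[OF C] provable_disjI1 provable_hyp) auto
      ultimately have "derivable S ?Fs \<Delta> (A \<^bold>\<or> B)"
        using BC Fs Gs assms(2) by (intro derivable_cut[of ?Fs \<Delta> "A \<^bold>\<or> B" C]) auto
      then have "derivable S ?Fs \<Delta> A"
        using BC Fs Gs assms(2) B by (intro derivable_cut[of ?Fs \<Delta> A B]) auto
      then show False
        using \<Delta>(3) Fs(1) Gs(1) unfolding D_def by (auto dest: spec[of _ ?Fs])
    qed
    show "\<exists>c \<in> constants S. B\<langle>Const c/x\<rangle> \<in> \<Delta>" if "Ex x B \<in> \<Delta>" for x B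
    proof -
      have F: "Ex x B \<in> Sent S"
        using that \<Delta>(2) by blast
      have "conclusion (Ex x B) \<in> \<Delta>"
        using D_witness[of "Ex x B" \<Delta>] that F conclusion_Sent[OF F] by (intro D_closed) auto
      then show ?thesis
        using Wit by auto
    qed
    \<comment> \<open>One of the given instances is that at the counterexample constant of
      \<open>All x B\<close>, which is the premise of its Henkin implication.\<close>
    show "All x B \<in> \<Delta>" if "All x B \<in> Sent S" "\<forall>c \<in> constants S. B\<langle>Const c/x\<rangle> \<in> \<Delta>" for x B
      using D_witness[of "All x B" \<Delta>] that Wit by (intro D_closed) auto
    show "\<exists>B \<in> Sent S. B \<notin> \<Delta>"
      using A_notin assms(2) by blast
  qed (fact sig \<Delta>(2))+
  then show thesis
    using that \<Delta>(1) A_notin by blast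
qed

end

section \<open>Conservativity of the extended signature\<close>

definition henkin_sig :: "('c, 'p) signature \<Rightarrow> (('c, 'p) henkin, 'p) signature" where
  "henkin_sig S = \<lparr>constants = Base ` constants S \<union> range Wit, predicates = predicates S,
    arity = arity S, ident = ident S\<rparr>"

lemma henkin_signature_henkin_sig: "is_signature S \<Longrightarrow> henkin_signature (henkin_sig S)"
  by unfold_locales
    (auto simp: is_signature_def henkin_sig_def finite_image_iff inj_on_def)

text \<open>A derivation involves finitely many witnesses. They are renamed to original constants
  that it does not use, of which the infinite signature has enough, while original constants keep
  their names.\<close>

lemma provable_henkin_sig_conservative:
  assumes sig: "is_signature S" and prov: "provable (henkin_sig S) (rename Base ` X) (rename Base A)"
  shows "provable S X A"
proof -
  obtain H where H: "H \<subseteq> rename Base ` X" "nd (henkin_sig S) H (rename Base A)"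
    using prov by (auto simp: provable_def)
  obtain K where K: "finite K" "K \<subseteq> constants (henkin_sig S)"
    "\<And>f. inj_on f K \<Longrightarrow> f ` K \<subseteq> constants S \<Longrightarrow> nd S (rename f ` H) (rename f (rename Base A))"
  proof -
    have "is_signature (henkin_sig S)"
      using henkin_signature_henkin_sig[OF sig] by (rule henkin_signature.sig)
    moreover have "predicates S = predicates (henkin_sig S)" "arity S = arity (henkin_sig S)"
      "ident S = ident (henkin_sig S)"
      by (simp_all add: henkin_sig_def)
    ultimately show thesis
      using nd_rename[OF _ H(2), of S] that by metis
  qed
  let ?W = "K \<inter> range Wit" and ?C = "Base -` K"
  have "infinite (constants S - ?C)"
    using K(1) sig by (intro Diff_infinite_finite finite_vimageI) (auto simp: is_signature_def inj_def)
  from infinite_arbitrarily_large[OF this, of "card ?W"]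
  obtain B where B: "finite B" "card B = card ?W" "B \<subseteq> constants S - ?C"
    by blast
  then obtain g where g: "bij_betw g ?W B"
    using K(1) finite_same_card_bij[of ?W B] by auto
  define f where "f c = (case c of Base d \<Rightarrow> d | Wit F \<Rightarrow> g c)" for c :: "('a, 'b) henkin"
  have f_Base: "f \<circ> Base = id"
    by (auto simp: f_def)
  have gB: "g c \<in> B" if "c \<in> ?W" for c
    using g that by (auto simp: bij_betw_def)
  have "inj_on f K"
  proof (rule inj_onI)
    fix c d
    assume cd: "c \<in> K" "d \<in> K" "f c = f d"
    show "c = d"
    proof (cases c)
      case c: (Base a)
      show ?thesis
      proof (cases d)
        case (Wit G)
        then have "a \<in> B"
          using cd gB[of d] by (simp add: f_def c)
        then show ?thesis
          using cd(1) B(3) c by auto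
      qed (use cd c in \<open>simp add: f_def\<close>)
    next
      case c: (Wit F)
      show ?thesis
      proof (cases d)
        case d: (Base a)
        then have "a \<in> B"
          using cd gB[of c] by (simp add: f_def c)
        then show ?thesis
          using cd(2) B(3) d by auto
      next
        case (Wit G)
        then show ?thesis
          using cd c g by (auto simp: f_def bij_betw_def dest: inj_onD)
      qed
    qed
  qed
  moreover have "f ` K \<subseteq> constants S"
  proof
    fix a
    assume "a \<in> f ` K"
    then obtain c where "c \<in> K" "a = f c"
      by blast
    then show "a \<in> constants S"
      using K(2) gB[of c] B(3) by (cases c) (auto simp: f_def henkin_sig_def)
  qed
  ultimately have nd: "nd S (rename f ` H) (rename f (rename Base A))"
    by (rule K(3))
  have inv: "rename f (rename Base B) = B" for B
    by (simp only: form.map_comp f_Base comp_id form.map_id)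
  have "rename f ` H \<subseteq> rename f ` rename Base ` X"
    using H(1) by (rule image_mono)
  also have "\<dots> = X"
    unfolding image_image inv by (rule image_ident)
  finally show ?thesis
    using nd unfolding provable_def inv by blast
qed

section \<open>The size of the language\<close>

text \<open>
  The canonical model must live on the type \<open>('c, 'p) form\<close>, so the witnessing constants, which are
  hereditarily built from formulas, are encoded injectively as formulas. The values need not be
  well formed.
\<close>

fun encode_trms :: "'p \<Rightarrow> ('c, 'p) form trm list \<Rightarrow> ('c, 'p) form" where
  "encode_trms P [] = Atom P []"
| "encode_trms P (Var x # ts) = All x (encode_trms P ts)"
| "encode_trms P (Const A # ts) = A \<^bold>\<and> encode_trms P ts"

text \<open>Decoding is determined by the outermost constructor: a quantifier marks a variable, a
  conjunction a constant, and an atom the end of the list.\<close>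

lemma encode_trms_inject:
  "encode_trms P ts = encode_trms Q us \<Longrightarrow> P = Q \<and> ts = us"
proof (induction P ts arbitrary: us rule: encode_trms.induct)
  case (1 P)
  then show ?case
    by (cases "(Q, us)" rule: encode_trms.cases) auto
next
  case (2 P x ts)
  then show ?case
    by (cases "(Q, us)" rule: encode_trms.cases) auto
next
  case (3 P A ts)
  then show ?case
    by (cases "(Q, us)" rule: encode_trms.cases) auto
qed

text \<open>Index 0 is reserved for coded atoms; the shift by \<open>Suc\<close> keeps genuine
  universal quantifiers apart from them.\<close>

primrec flatten :: "(('c, 'p) form, 'p) form \<Rightarrow> ('c, 'p) form" where
  "flatten (Atom P ts) = All 0 (encode_trms P ts)"
| "flatten (\<^bold>\<not> A) = \<^bold>\<not> (flatten A)"
| "flatten (\<^bold>\<circ> A) = \<^bold>\<circ> (flatten A)"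
| "flatten (\<^bold>\<bullet> A) = \<^bold>\<bullet> (flatten A)"
| "flatten (A \<^bold>\<and> B) = flatten A \<^bold>\<and> flatten B"
| "flatten (A \<^bold>\<or> B) = flatten A \<^bold>\<or> flatten B"
| "flatten (All x A) = All (Suc x) (flatten A)"
| "flatten (Ex x A) = Ex x (flatten A)"

lemma flatten_inject: "flatten A = flatten B \<Longrightarrow> A = B"
proof (induction A arbitrary: B)
  case (Atom P ts)
  then show ?case
    by (cases B) (auto dest: encode_trms_inject)
next
  case (Neg A)
  then show ?case by (cases B) auto
next
  case (Circ A)
  then show ?case by (cases B) auto
next
  case (Bul A)
  then show ?case by (cases B) auto
next
  case (Conj A1 A2)
  then show ?case by (cases B) auto
next
  case (Disj A1 A2)
  then show ?case by (cases B) auto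
next
  case (All x A)
  then show ?case by (cases B) auto
next
  case (Ex x A)
  then show ?case by (cases B) auto
qed

text \<open>Atom against negation separates base constants from witnesses; \<open>undefined\<close>
  is an arbitrary fixed predicate letter.\<close>

primrec encode :: "('c, 'p) henkin \<Rightarrow> ('c, 'p) form" where
  "encode (Base c) = Atom undefined [Const c]"
| "encode (Wit F) = \<^bold>\<not> (flatten (map_form encode id F))"

lemma inj_encode: "inj encode"
proof (rule injI)
  show "encode c = encode d \<Longrightarrow> c = d" for c d :: "('a, 'b) henkin"
  proof (induction c arbitrary: d)
    case (Base c)
    then show ?case
      by (cases d) auto
  next
    case (Wit F)
    then obtain G where d: "d = Wit G"
      by (cases d) auto
    then have eq: "rename encode F = rename encode G"
      using Wit.prems by (auto dest: flatten_inject)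
    \<comment> \<open>The induction hypothesis gives injectivity of \<open>encode\<close> only at
      the constants of \<open>F\<close>, which suffices here.\<close>
    have "F = G"
      by (rule form.inj_map_strong[OF _ _ eq]) (use Wit.IH in auto)
    then show ?case
      by (simp add: d)
  qed
qed

section \<open>Completeness: a countermodel from underivability\<close>

theorem theorem19:
  fixes S :: "('c, 'p) signature"
    and \<Gamma> :: "('c, 'p) form set"
    and A :: "('c, 'p) form"
  assumes "is_signature S"
    and "\<Gamma> \<union> {A} \<subseteq> Sent S"
    and "consequence TYPE(('c, 'p) form) S \<Gamma> A"
  shows "provable S \<Gamma> A"
proof (rule ccontr)
  let ?S = "henkin_sig S"
  assume "\<not> provable S \<Gamma> A"
  then have not_provable: "\<not> provable ?S (rename Base ` \<Gamma>) (rename Base A)"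
    using provable_henkin_sig_conservative[OF assms(1)] by blast
  have Base: "rename Base B \<in> Sent ?S" if "B \<in> Sent S" for B
    using csts_Sent[OF that] by (intro Sent_rename[OF that]) (auto simp: henkin_sig_def)
  obtain \<Delta> where \<Delta>: "henkin_theory ?S \<Delta>" "rename Base ` \<Gamma> \<subseteq> \<Delta>" "rename Base A \<notin> \<Delta>"
  proof (rule henkin_signature.henkin_extension[OF henkin_signature_henkin_sig[OF assms(1)]])
    show "rename Base ` \<Gamma> \<subseteq> Sent ?S" "rename Base A \<in> Sent ?S"
      using Base assms(2) by auto
  qed (use not_provable in auto)
  \<comment> \<open>The canonical model is built for the original signature: constants are
    interpreted through \<open>Base\<close>, and \<open>encode\<close> places the domain inside the
    type of formulas.\<close>
  obtain M :: "('c, 'p, ('c, 'p) form) struct" and v where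
    M: "is_struct S M" "valuation S M v" and
    v: "\<And>B. B \<in> Sent S \<Longrightarrow> v (embed B) \<longleftrightarrow> rename Base B \<in> \<Delta>"
    by (rule henkin_theory.canonical_model[OF \<Delta>(1), of S Base encode])
      (auto simp: henkin_sig_def inj_encode)
  have "\<forall>B \<in> \<Gamma>. v (embed B)"
    using v \<Delta>(2) assms(2) by blast
  then have "v (embed A)"
    using assms(3) M unfolding consequence_def by blast
  then show False
    using v \<Delta>(3) assms(2) by blast
qed

end
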